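(* Under the standing assumptions given in the context, the equation $y'(t)+Ay(t)+B(t)y(t)=D(t)u(t)$, $t\ge0$, is linear periodic feedback stabilizable (LPFS) if and only if it is LPFS with respect to some finite dimensional subspace $Z$ of $U$.
   Context: Standing assumptions. $H$ and $U$ are real Hilbert spaces, identified with their duals; $\mathcal{L}(X,Y)$ is the space of bounded linear operators, $\mathcal{L}(X)=\mathcal{L}(X,X)$; $\mathbb{R}^+=[0,\infty)$; $T>0$. The operator $-A$ generates a compact $C_0$-semigroup $\{S(t)\}_{t\ge 0}$ on $H$ (i.e. $S(t)$ is compact for $t>0$). $B(\cdot)\in L^1_{loc}(\mathbb{R}^+;\mathcal{L}(H))$ is $T$-periodic ($B(t+T)=B(t)$ for a.e. $t$), and $D(\cdot)\in L^\infty(\mathbb{R}^+;\mathcal{L}(U,H))$ is $T$-periodic. Controls $u$ are in $L^2(\mathbb{R}^+;U)$; solutions are mild solutions. LPFS. The equation is linear periodic feedback stabilizable (LPFS) if there is a $T$-periodic $K(\cdot)\in L^\infty(\mathbb{R}^+;\mathcal{L}(H,U))$ such that the feedback equation $y'(t)+Ay(t)+B(t)y(t)=D(t)K(t)y(t)$ on $\mathbb{R}^+$ is exponentially stable, i.e. there are constants $M,\delta>0$ such that for every $h\in H$ its mild solution $y_K(\cdot;0,h)$ with $y(0)=h$ satisfies $\|y_K(t;0,h)\|\le Me^{-\delta t}\|h\|$ for all $t\ge0$. It is LPFS with respect to a subspace $Z$ of $U$ if the same holds with some $T$-periodic $K(\cdot)\in L^\infty(\mathbb{R}^+;\mathcal{L}(H,Z))$.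 *)

theory Defs
  imports "HOL-Analysis.Analysis"
begin

text \<open>
  Real Hilbert spaces are types of sort \<open>{real_inner, banach}\<close>; separability is not assumed.
  Functions on \<open>[0, \<infinity>)\<close> are represented by functions on \<^typ>\<open>real\<close> of which only
  the values at nonnegative arguments are used.
\<close>


section \<open>Bochner measurability and integration\<close>

text \<open>
  The Bochner integral of HOL-Analysis is restricted to second countable spaces, which
  excludes non-separable Hilbert spaces and, in general, spaces of bounded operators with the
  operator norm.  The notions below carry no such restriction.
\<close>

definition strongly_measurable :: "'a measure \<Rightarrow> ('a \<Rightarrow> 'b::real_normed_vector) \<Rightarrow> bool" where
  "strongly_measurable M f \<longleftrightarrow>
    (\<exists>s. (\<forall>i::nat. simple_function M (s i)) \<and> (AE x in M. (\<lambda>i. s i x) \<longlonglongrightarrow> f x))"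

text \<open>
  This is \<^const>\<open>has_bochner_integral\<close> without the sort constraint.
\<close>

definition has_vector_bochner_integral ::
    "'a measure \<Rightarrow> ('a \<Rightarrow> 'b::real_normed_vector) \<Rightarrow> 'b \<Rightarrow> bool" where
  "has_vector_bochner_integral M f x \<longleftrightarrow>
    f \<in> borel_measurable M \<and>
    (\<exists>s. (\<forall>i::nat. Bochner_Integration.simple_bochner_integrable M (s i)) \<and>
         (\<lambda>i. \<integral>\<^sup>+ t. ennreal (norm (f t - s i t)) \<partial>M) \<longlonglongrightarrow> 0 \<and>
         (\<lambda>i. Bochner_Integration.simple_bochner_integral M (s i)) \<longlonglongrightarrow> x)"

definition L1_loc :: "(real \<Rightarrow> 'b::real_normed_vector) \<Rightarrow> bool" where
  "L1_loc f \<longleftrightarrow>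
    (\<forall>a\<ge>0. strongly_measurable (lebesgue_on {0..a}) f \<and>
           (\<integral>\<^sup>+ t. ennreal (norm (f t)) \<partial>lebesgue_on {0..a}) < \<infinity>)"

definition L_infinity :: "(real \<Rightarrow> 'b::real_normed_vector) \<Rightarrow> bool" where
  "L_infinity f \<longleftrightarrow>
    strongly_measurable (lebesgue_on {0..}) f \<and>
    (\<exists>C. AE t in lebesgue_on {0..}. norm (f t) \<le> C)"

definition periodic_ae :: "real \<Rightarrow> (real \<Rightarrow> 'b) \<Rightarrow> bool" where
  "periodic_ae T f \<longleftrightarrow> (AE t in lebesgue_on {0..}. f (t + T) = f t)"


section \<open>Compact strongly continuous semigroups\<close>

definition C0_semigroup :: "(real \<Rightarrow> 'h::real_normed_vector \<Rightarrow>\<^sub>L 'h) \<Rightarrow> bool" where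
  "C0_semigroup S \<longleftrightarrow>
    S 0 = id_blinfun \<and>
    (\<forall>s\<ge>0. \<forall>t\<ge>0. S (s + t) = S s o\<^sub>L S t) \<and>
    (\<forall>x. ((\<lambda>t. S t x) \<longlongrightarrow> x) (at_right 0))"

text \<open>
  An unbounded operator is given by its domain \<open>domG\<close> and a function \<open>G\<close> whose
  values outside \<open>domG\<close> are irrelevant.
\<close>

definition generates ::
    "'h set \<Rightarrow> ('h \<Rightarrow> 'h) \<Rightarrow> (real \<Rightarrow> 'h::real_normed_vector \<Rightarrow>\<^sub>L 'h) \<Rightarrow> bool" where
  "generates domG G S \<longleftrightarrow>
    C0_semigroup S \<and>
    domG = {x. \<exists>y. ((\<lambda>t. (S t x - x) /\<^sub>R t) \<longlongrightarrow> y) (at_right 0)} \<and>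
    (\<forall>x\<in>domG. ((\<lambda>t. (S t x - x) /\<^sub>R t) \<longlongrightarrow> G x) (at_right 0))"

definition compact_operator ::
    "('a::real_normed_vector \<Rightarrow>\<^sub>L 'b::real_normed_vector) \<Rightarrow> bool" where
  "compact_operator F \<longleftrightarrow> (\<forall>X. bounded X \<longrightarrow> compact (closure (blinfun_apply F ` X)))"


section \<open>Mild solutions and periodic feedback stabilization\<close>

text \<open>
  Mild solutions of \<open>y'(t) + A y(t) + B(t) y(t) = D(t) u(t)\<close>, \<open>y(0) = h\<close>, where
  \<open>S\<close> is the semigroup generated by \<open>-A\<close>: continuous \<open>y\<close> with
  \<open>y(t) = S(t) h + \<integral>\<^sub>0\<^sup>t S(t - s) (D(s) u(s) - B(s) y(s)) ds\<close>.
\<close>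

definition mild_solution ::
    "(real \<Rightarrow> 'h::real_normed_vector \<Rightarrow>\<^sub>L 'h) \<Rightarrow> (real \<Rightarrow> 'h \<Rightarrow>\<^sub>L 'h) \<Rightarrow>
     (real \<Rightarrow> 'u::real_normed_vector \<Rightarrow>\<^sub>L 'h) \<Rightarrow> (real \<Rightarrow> 'u) \<Rightarrow> 'h \<Rightarrow> (real \<Rightarrow> 'h) \<Rightarrow> bool" where
  "mild_solution S B D u h y \<longleftrightarrow>
    continuous_on {0..} y \<and>
    (\<forall>t\<ge>0. has_vector_bochner_integral (lebesgue_on {0..t})
       (\<lambda>s. S (t - s) (D s (u s) - B s (y s))) (y t - S t h))"

definition feedback_solution ::
    "(real \<Rightarrow> 'h::real_normed_vector \<Rightarrow>\<^sub>L 'h) \<Rightarrow> (real \<Rightarrow> 'h \<Rightarrow>\<^sub>L 'h) \<Rightarrow>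
     (real \<Rightarrow> 'u::real_normed_vector \<Rightarrow>\<^sub>L 'h) \<Rightarrow> (real \<Rightarrow> 'h \<Rightarrow>\<^sub>L 'u) \<Rightarrow> 'h \<Rightarrow> (real \<Rightarrow> 'h) \<Rightarrow> bool" where
  "feedback_solution S B D K h y \<longleftrightarrow> mild_solution S B D (\<lambda>t. K t (y t)) h y"

text \<open>
  Mild solutions are unique on \<open>[0, \<infinity>)\<close> only, so the decay estimate is required of every
  representing function; the existence conjunct keeps that requirement from being vacuous.
\<close>

definition exponentially_stable ::
    "(real \<Rightarrow> 'h::real_normed_vector \<Rightarrow>\<^sub>L 'h) \<Rightarrow> (real \<Rightarrow> 'h \<Rightarrow>\<^sub>L 'h) \<Rightarrow>
     (real \<Rightarrow> 'u::real_normed_vector \<Rightarrow>\<^sub>L 'h) \<Rightarrow> (real \<Rightarrow> 'h \<Rightarrow>\<^sub>L 'u) \<Rightarrow> bool" where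
  "exponentially_stable S B D K \<longleftrightarrow>
    (\<exists>M>0. \<exists>\<delta>>0. \<forall>h.
       (\<exists>y. feedback_solution S B D K h y) \<and>
       (\<forall>y. feedback_solution S B D K h y \<longrightarrow>
            (\<forall>t\<ge>0. norm (y t) \<le> M * exp (- \<delta> * t) * norm h)))"

definition LPFS ::
    "(real \<Rightarrow> 'h::real_normed_vector \<Rightarrow>\<^sub>L 'h) \<Rightarrow> (real \<Rightarrow> 'h \<Rightarrow>\<^sub>L 'h) \<Rightarrow>
     (real \<Rightarrow> 'u::real_normed_vector \<Rightarrow>\<^sub>L 'h) \<Rightarrow> real \<Rightarrow> bool" where
  "LPFS S B D T \<longleftrightarrow>
    (\<exists>K :: real \<Rightarrow> 'h \<Rightarrow>\<^sub>L 'u.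
       L_infinity K \<and> periodic_ae T K \<and> exponentially_stable S B D K)"

text \<open>
  An element of \<open>L\<^sup>\<infinity>([0, \<infinity>); L(H, Z))\<close> is rendered as an element of
  \<open>L\<^sup>\<infinity>([0, \<infinity>); L(H, U))\<close> whose values map into \<open>Z\<close> almost everywhere.
\<close>

definition LPFS_wrt ::
    "'u set \<Rightarrow> (real \<Rightarrow> 'h::real_normed_vector \<Rightarrow>\<^sub>L 'h) \<Rightarrow> (real \<Rightarrow> 'h \<Rightarrow>\<^sub>L 'h) \<Rightarrow>
     (real \<Rightarrow> 'u::real_normed_vector \<Rightarrow>\<^sub>L 'h) \<Rightarrow> real \<Rightarrow> bool" where
  "LPFS_wrt Z S B D T \<longleftrightarrow>
    (\<exists>K :: real \<Rightarrow> 'h \<Rightarrow>\<^sub>L 'u.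
       L_infinity K \<and> (AE t in lebesgue_on {0..}. range (blinfun_apply (K t)) \<subseteq> Z) \<and>
       periodic_ae T K \<and> exponentially_stable S B D K)"

end

theory Submission
  imports Defs
begin

text \<open>
  A feedback with values in a finite dimensional subspace is a feedback, so one direction is
  immediate.  For the other one, let \<open>K\<close> be a stabilizing feedback.  The new feedback is \<open>P K\<close>, where
  \<open>P\<close> is the orthogonal projection onto a suitable finite dimensional subspace of the control space.
  It inherits periodicity and boundedness from \<open>K\<close>.

  \<^emph>\<open>Why it stabilizes.\<close>  Fix a multiple \<open>\<tau>\<close> of the period with \<open>norm (y \<tau>) \<le> 1/4 * norm h\<close> for every
  solution \<open>y\<close> of the closed loop of \<open>K\<close> with initial value \<open>h\<close>.  If every solution \<open>y'\<close> of the closed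
  loop of \<open>P K\<close> satisfies \<open>norm (y' t - y t) \<le> 1/4 * norm h\<close> on \<open>[0, \<tau>]\<close>, then it contracts by \<open>1/2\<close>
  over \<open>[0, \<tau>]\<close>; as the coefficients are \<open>\<tau>\<close>-periodic, translates of solutions are solutions
  (\<open>evolution_solution_shift\<close>), and iteration gives exponential decay
  (\<open>exponentially_stable_if_contracting\<close>).

  \<^emph>\<open>Why the two solutions are close.\<close>  Their difference satisfies a linear integral inequality whose
  inhomogeneity is controlled by \<open>norm (S (t - s) (D s (u - P u)))\<close>.  The feedback \<open>P K\<close> may be far
  from \<open>K\<close> in norm, but the compact operator \<open>S (t - s)\<close> smooths the discrepancy: for a compact
  operator \<open>G\<close> and finitely many operators \<open>F\<close> there is a projection \<open>P\<close> of finite rank such that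
  \<open>G F (u - P u)\<close> is small uniformly in the unit ball (\<open>finite_rank_approximation\<close>).  The function
  \<open>D\<close> is reduced to finitely many operators by approximating it in \<open>L\<^sup>1\<close> by a simple function, and
  \<open>S (t - s)\<close> to the single compact operator \<open>S \<eta>\<close> by treating the interval \<open>[t - \<eta>, t]\<close> separately
  (\<open>finite_rank_feedback_approximation\<close>).

  \<^emph>\<open>Existence.\<close>  Stability of the new closed loop includes the existence of mild solutions for all
  initial values, which Picard iteration provides (\<open>evolution_solution_exists\<close>).  Both this iteration
  and the comparison of the two closed loops rest on one estimate for integrable kernels
  (\<open>exponential_weight_exists\<close>): with respect to a sufficiently steep exponential weight the kernel
  acts as a contraction.
\<close>

section \<open>Bochner integrals in non-separable spaces\<close>

text \<open>
  A Borel function is obtained by setting everything to \<open>0\<close> on the exceptional null set;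
  completeness of \<open>M\<close> then makes every modification on that null set measurable.
\<close>

lemma strongly_measurable_imp_borel_measurable:
  fixes f :: "'a \<Rightarrow> 'b::real_normed_vector"
  assumes "complete_measure M" and "strongly_measurable M f"
  shows "f \<in> borel_measurable M"
proof -
  interpret complete_measure M by fact
  obtain s where s: "\<And>i::nat. simple_function M (s i)"
    and lim: "AE x in M. (\<lambda>i. s i x) \<longlonglongrightarrow> f x"
    using assms(2) unfolding strongly_measurable_def by blast
  obtain N where N: "N \<in> null_sets M" and sub: "{x\<in>space M. \<not> (\<lambda>i. s i x) \<longlonglongrightarrow> f x} \<subseteq> N"
    using lim unfolding eventually_ae_filter by blast
  have [measurable]: "N \<in> sets M" "\<And>i. s i \<in> borel_measurable M"
    using N s by (auto intro: borel_measurable_simple_function)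
  have g: "(\<lambda>x. if x \<in> N then 0 else f x) \<in> borel_measurable M"
  proof (rule borel_measurable_LIMSEQ_metric)
    show "(\<lambda>x. if x \<in> N then 0 else s i x) \<in> borel_measurable M" for i by measurable
    show "(\<lambda>i. if x \<in> N then 0 else s i x) \<longlonglongrightarrow> (if x \<in> N then 0 else f x)" if "x \<in> space M" for x
      using that sub by auto
  qed
  show ?thesis
  proof (rule measurableI)
    fix X :: "'b set" assume X: "X \<in> sets borel"
    have 1: "(\<lambda>x. if x \<in> N then 0 else f x) -` X \<inter> space M - N \<in> sets M"
      using measurable_sets[OF g X] by auto
    have 2: "f -` X \<inter> space M \<inter> N \<in> sets M"
      using N complete[of "f -` X \<inter> space M \<inter> N" N] by blast
    have "f -` X \<inter> space M =
      ((\<lambda>x. if x \<in> N then 0 else f x) -` X \<inter> space M - N) \<union> (f -` X \<inter> space M \<inter> N)"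
      by auto
    then show "f -` X \<inter> space M \<in> sets M" using 1 2 by (metis sets.Un)
  qed auto
qed

lemma complete_measure_lebesgue_on: "S \<in> sets lebesgue \<Longrightarrow> complete_measure (lebesgue_on S)"
proof
  fix A B assume S: "S \<in> sets lebesgue" and "B \<subseteq> A" "A \<in> null_sets (lebesgue_on S)"
  then have A: "A \<in> null_sets lebesgue" "A \<subseteq> S"
    using null_sets_restrict_space[OF S] by auto
  then have "B \<in> null_sets lebesgue"
    using \<open>B \<subseteq> A\<close> completion.complete2 by blast
  then show "B \<in> sets (lebesgue_on S)"
    using \<open>B \<subseteq> A\<close> A(2) S by (auto simp: sets_restrict_space_iff)
qed

text \<open>
  In a non-separable space the sum of two Borel functions can fail to be Borel, because the
  product \<open>\<sigma>\<close>-algebra is too small to contain the open sets of the product.  Strong measurability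
  survives, since pairs of simple functions are again simple.
\<close>

lemma strongly_measurable_compose2:
  assumes f: "strongly_measurable M f" and g: "strongly_measurable M g"
    and cont: "continuous_on UNIV (\<lambda>(x, y). h x y)"
  shows "strongly_measurable M (\<lambda>x. h (f x) (g x))"
proof -
  obtain s where s: "\<And>i::nat. simple_function M (s i)"
    and ls: "AE x in M. (\<lambda>i. s i x) \<longlonglongrightarrow> f x"
    using f unfolding strongly_measurable_def by blast
  obtain r where r: "\<And>i::nat. simple_function M (r i)"
    and lr: "AE x in M. (\<lambda>i. r i x) \<longlonglongrightarrow> g x"
    using g unfolding strongly_measurable_def by blast
  have "AE x in M. (\<lambda>i. h (s i x) (r i x)) \<longlonglongrightarrow> h (f x) (g x)"
    using ls lr
  proof eventually_elim
    fix x assume "(\<lambda>i. s i x) \<longlonglongrightarrow> f x" "(\<lambda>i. r i x) \<longlonglongrightarrow> g x"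
    then have "(\<lambda>i. (s i x, r i x)) \<longlonglongrightarrow> (f x, g x)" by (rule tendsto_Pair)
    moreover have "isCont (\<lambda>(x, y). h x y) (f x, g x)"
      using cont by (simp add: continuous_on_eq_continuous_at)
    ultimately show "(\<lambda>i. h (s i x) (r i x)) \<longlonglongrightarrow> h (f x) (g x)"
      using isCont_tendsto_compose by fastforce
  qed
  moreover have "simple_function M (\<lambda>x. h (s i x) (r i x))" for i
    by (rule simple_function_compose2[OF s r])
  ultimately show ?thesis
    unfolding strongly_measurable_def by (intro exI[of _ "\<lambda>i x. h (s i x) (r i x)"]) auto
qed

lemma strongly_measurable_compose:
  assumes "strongly_measurable M f" and "continuous_on UNIV h"
  shows "strongly_measurable M (\<lambda>x. h (f x))"
proof (rule strongly_measurable_compose2[OF assms(1) assms(1), of "\<lambda>x _. h x"])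
  show "continuous_on UNIV (\<lambda>(x, y). h x)"
    unfolding case_prod_beta by (intro continuous_on_compose2[OF assms(2)] continuous_intros) auto
qed

lemma strongly_measurable_cong_AE:
  assumes "strongly_measurable M f" and "AE x in M. f x = g x"
  shows "strongly_measurable M g"
proof -
  obtain s where s: "\<And>i::nat. simple_function M (s i)"
    and ls: "AE x in M. (\<lambda>i. s i x) \<longlonglongrightarrow> f x"
    using assms(1) unfolding strongly_measurable_def by blast
  from ls assms(2) have "AE x in M. (\<lambda>i. s i x) \<longlonglongrightarrow> g x"
    by eventually_elim simp
  with s show ?thesis unfolding strongly_measurable_def by blast
qed

lemma strongly_measurable_cong:
  "strongly_measurable M f \<Longrightarrow> (\<And>x. x \<in> space M \<Longrightarrow> f x = g x) \<Longrightarrow> strongly_measurable M g"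
  by (erule strongly_measurable_cong_AE) (auto intro: AE_I2)

lemma simple_function_restrict_subset:
  assumes "simple_function (lebesgue_on S) f" "R \<subseteq> S" "R \<in> sets lebesgue" "S \<in> sets lebesgue"
  shows "simple_function (lebesgue_on R) f"
  unfolding simple_function_def
proof safe
  show "finite (f ` space (lebesgue_on R))"
    using assms(1,2) unfolding simple_function_def by (auto intro: finite_subset[OF image_mono])
  fix x assume "x \<in> space (lebesgue_on R)"
  then have "f -` {f x} \<inter> S \<in> sets (lebesgue_on S)"
    using assms(1,2) unfolding simple_function_def by auto
  then have "f -` {f x} \<inter> S \<in> sets lebesgue"
    using assms(4) by (auto simp: sets_restrict_space_iff)
  then have "(f -` {f x} \<inter> S) \<inter> R \<in> sets lebesgue" using assms(3) by blast
  moreover have "(f -` {f x} \<inter> S) \<inter> R = f -` {f x} \<inter> R" using assms(2) by auto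
  ultimately show "f -` {f x} \<inter> space (lebesgue_on R) \<in> sets (lebesgue_on R)"
    using assms(3) by (auto simp: sets_restrict_space_iff)
qed

lemma AE_lebesgue_on_iff:
  "S \<in> sets lebesgue \<Longrightarrow> (AE x in lebesgue_on S. P x) \<longleftrightarrow> (AE x in lebesgue. x \<in> S \<longrightarrow> P x)"
  by (subst AE_restrict_space_iff) auto

lemma AE_lebesgue_on_subset:
  assumes "AE x in lebesgue_on S. P x" "R \<subseteq> S" "R \<in> sets lebesgue" "S \<in> sets lebesgue"
  shows "AE x in lebesgue_on R. P x"
  using assms by (auto simp: AE_lebesgue_on_iff elim!: eventually_mono)

lemma strongly_measurable_restrict_subset:
  assumes "strongly_measurable (lebesgue_on S) f" "R \<subseteq> S" "R \<in> sets lebesgue" "S \<in> sets lebesgue"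
  shows "strongly_measurable (lebesgue_on R) f"
  using assms unfolding strongly_measurable_def
  by (meson AE_lebesgue_on_subset simple_function_restrict_subset)

text \<open>
  The approximants sample \<open>f\<close> at the grid point \<open>\<lfloor>(i+1) x\<rfloor> / (i+1)\<close> below \<open>x\<close>; the maximum with
  \<open>a\<close> keeps the sample inside the interval.
\<close>

lemma strongly_measurable_continuous:
  fixes f :: "real \<Rightarrow> 'b::real_normed_vector"
  assumes "continuous_on {a..b} f"
  shows "strongly_measurable (lebesgue_on {a..b}) f"
proof -
  define q where "q i x = max a (real_of_int \<lfloor>real (Suc i) * x\<rfloor> / real (Suc i))" for i x
  have "simple_function (lebesgue_on {a..b}) (\<lambda>x. \<lfloor>real (Suc i) * x\<rfloor>)" for i
    unfolding simple_function_def
  proof safe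
    have "(\<lambda>x. \<lfloor>real (Suc i) * x\<rfloor>) ` {a..b} \<subseteq> {\<lfloor>real (Suc i) * a\<rfloor>..\<lfloor>real (Suc i) * b\<rfloor>}"
      by (auto simp del: of_nat_Suc intro!: floor_mono mult_left_mono)
    then show "finite ((\<lambda>x. \<lfloor>real (Suc i) * x\<rfloor>) ` space (lebesgue_on {a..b}))"
      by (simp add: finite_subset del: of_nat_Suc)
    fix x :: real
    have "(\<lambda>x. real_of_int \<lfloor>real (Suc i) * x\<rfloor>) \<in> borel_measurable (lebesgue_on {a..b})"
      by (rule measurable_restrict_space1[OF measurable_completion]) measurable
    then have "(\<lambda>x. real_of_int \<lfloor>real (Suc i) * x\<rfloor>) -` {real_of_int \<lfloor>real (Suc i) * x\<rfloor>} \<inter>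
        space (lebesgue_on {a..b}) \<in> sets (lebesgue_on {a..b})"
      by (rule measurable_sets) auto
    then show "(\<lambda>x. \<lfloor>real (Suc i) * x\<rfloor>) -` {\<lfloor>real (Suc i) * x\<rfloor>} \<inter> space (lebesgue_on {a..b})
        \<in> sets (lebesgue_on {a..b})"
      by (simp add: vimage_def)
  qed
  then have "simple_function (lebesgue_on {a..b}) (\<lambda>x. f (q i x))" for i
    unfolding q_def by (rule simple_function_compose1)
  moreover have "(\<lambda>i. f (q i x)) \<longlonglongrightarrow> f x" if x: "x \<in> {a..b}" for x
  proof -
    have "(\<lambda>i. real_of_int \<lfloor>real (Suc i) * x\<rfloor> / real (Suc i)) \<longlonglongrightarrow> x"
    proof (rule tendsto_sandwich)
      show "\<forall>\<^sub>F i in sequentially. x - 1 / real (Suc i) \<le> real_of_int \<lfloor>real (Suc i) * x\<rfloor> / real (Suc i)"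
      proof (rule always_eventually, rule allI)
        fix i
        have "real (Suc i) * x - 1 \<le> real_of_int \<lfloor>real (Suc i) * x\<rfloor>" by linarith
        then have "(real (Suc i) * x - 1) / real (Suc i) \<le> real_of_int \<lfloor>real (Suc i) * x\<rfloor> / real (Suc i)"
          by (rule divide_right_mono) auto
        then show "x - 1 / real (Suc i) \<le> real_of_int \<lfloor>real (Suc i) * x\<rfloor> / real (Suc i)"
          by (simp add: diff_divide_distrib)
      qed
      show "\<forall>\<^sub>F i in sequentially. real_of_int \<lfloor>real (Suc i) * x\<rfloor> / real (Suc i) \<le> x"
      proof (rule always_eventually, rule allI)
        fix i
        have "real_of_int \<lfloor>real (Suc i) * x\<rfloor> \<le> x * real (Suc i)" by (simp add: mult.commute)
        then show "real_of_int \<lfloor>real (Suc i) * x\<rfloor> / real (Suc i) \<le> x"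
          by (simp add: pos_divide_le_eq del: of_nat_Suc)
      qed
      show "(\<lambda>i. x - 1 / real (Suc i)) \<longlonglongrightarrow> x"
        using tendsto_diff[OF tendsto_const LIMSEQ_Suc[OF lim_1_over_n]] by simp
    qed auto
    then have "(\<lambda>i. q i x) \<longlonglongrightarrow> max a x" unfolding q_def by (intro tendsto_intros)
    then have lim: "(\<lambda>i. q i x) \<longlonglongrightarrow> x" using x by (simp add: max_def)
    have "q i x \<in> {a..b}" for i
    proof -
      have "real_of_int \<lfloor>real (Suc i) * x\<rfloor> \<le> x * real (Suc i)" by (simp add: mult.commute)
      then have "real_of_int \<lfloor>real (Suc i) * x\<rfloor> / real (Suc i) \<le> x"
        by (simp add: pos_divide_le_eq del: of_nat_Suc)
      then show ?thesis using x unfolding q_def by auto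
    qed
    then show ?thesis
      using continuous_on_tendsto_compose[OF assms lim x] by auto
  qed
  ultimately show ?thesis
    unfolding strongly_measurable_def by (intro exI[of _ "\<lambda>i x. f (q i x)"]) (auto intro!: AE_I2)
qed

text \<open>
  The simple functions that approximate \<open>f\<close> almost everywhere need not be dominated.  Cutting the
  \<open>i\<close>-th one off outside the set where its error is at most \<open>norm f + 1\<close> keeps it simple, changes it
  at almost every point for finitely many \<open>i\<close> only, and makes \<open>norm f + 1\<close> an integrable majorant of
  the errors.
\<close>

lemma simple_L1_approximation:
  fixes f :: "'a \<Rightarrow> 'b::real_normed_vector"
  assumes "complete_measure M" "finite_measure M"
    and f: "strongly_measurable M f" and fin: "(\<integral>\<^sup>+ x. ennreal (norm (f x)) \<partial>M) < \<infinity>"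
  obtains s where "\<And>i::nat. Bochner_Integration.simple_bochner_integrable M (s i)"
    and "\<And>i. (\<lambda>x. norm (f x - s i x)) \<in> borel_measurable M"
    and "(\<lambda>i. \<integral>\<^sup>+ x. ennreal (norm (f x - s i x)) \<partial>M) \<longlonglongrightarrow> 0"
proof -
  interpret finite_measure M by fact
  obtain s where s: "\<And>i::nat. simple_function M (s i)"
    and lim: "AE x in M. (\<lambda>i. s i x) \<longlonglongrightarrow> f x"
    using f unfolding strongly_measurable_def by blast
  have fm: "f \<in> borel_measurable M"
    by (rule strongly_measurable_imp_borel_measurable[OF assms(1) f])
  have sm: "strongly_measurable M (\<lambda>x. norm (f x - s i x))" for i
  proof -
    have "strongly_measurable M (s i)"
      unfolding strongly_measurable_def using s by (intro exI[of _ "\<lambda>_. s i"]) auto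
    then show ?thesis
      by (rule strongly_measurable_compose2[OF f])
         (auto simp: case_prod_beta intro!: continuous_intros)
  qed
  have [measurable]: "(\<lambda>x. norm (f x - s i x)) \<in> borel_measurable M" for i
    by (rule strongly_measurable_imp_borel_measurable[OF assms(1) sm])
  have [measurable]: "(\<lambda>x. norm (f x)) \<in> borel_measurable M"
    by (rule measurable_compose[OF fm]) measurable
  define A where "A i = {x \<in> space M. norm (f x - s i x) \<le> norm (f x) + 1}" for i
  have A[measurable]: "A i \<in> sets M" for i unfolding A_def by measurable
  define s' where "s' i x = indicator (A i) x *\<^sub>R s i x" for i x
  have s': "simple_function M (s' i)" for i
    unfolding s'_def by (rule simple_function_compose2[OF simple_function_indicator[OF A] s])
  have bi: "Bochner_Integration.simple_bochner_integrable M (s' i)" for i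
    using s' by (auto simp: Bochner_Integration.simple_bochner_integrable.simps)
  have sm': "strongly_measurable M (\<lambda>x. norm (f x - s' i x))" for i
  proof -
    have "strongly_measurable M (s' i)"
      unfolding strongly_measurable_def using s' by (intro exI[of _ "\<lambda>_. s' i"]) auto
    then show ?thesis
      by (rule strongly_measurable_compose2[OF f])
         (auto simp: case_prod_beta intro!: continuous_intros)
  qed
  have m'[measurable]: "(\<lambda>x. norm (f x - s' i x)) \<in> borel_measurable M" for i
    by (rule strongly_measurable_imp_borel_measurable[OF assms(1) sm'])
  have "(\<lambda>i. \<integral>\<^sup>+ x. ennreal (norm (f x - s' i x)) \<partial>M) \<longlonglongrightarrow> (\<integral>\<^sup>+ x. 0 \<partial>M)"
  proof (rule nn_integral_dominated_convergence[where w = "\<lambda>x. ennreal (norm (f x) + 1)"])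
    show "AE x in M. ennreal (norm (f x - s' i x)) \<le> ennreal (norm (f x) + 1)" for i
    proof (rule AE_I2)
      fix x assume "x \<in> space M"
      then show "ennreal (norm (f x - s' i x)) \<le> ennreal (norm (f x) + 1)"
        by (cases "x \<in> A i") (auto simp: s'_def A_def simp del: ennreal_plus intro!: ennreal_leI)
    qed
    have "(\<integral>\<^sup>+ x. ennreal (norm (f x) + 1) \<partial>M) = (\<integral>\<^sup>+ x. ennreal (norm (f x)) \<partial>M) + emeasure M (space M)"
      by (simp add: nn_integral_add)
    also have "\<dots> < \<infinity>" using fin emeasure_finite[of "space M"] by (auto simp: less_top[symmetric])
    finally show "(\<integral>\<^sup>+ x. ennreal (norm (f x) + 1) \<partial>M) < \<infinity>" .
    show "AE x in M. (\<lambda>i. ennreal (norm (f x - s' i x))) \<longlonglongrightarrow> 0"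
      using lim AE_space
    proof eventually_elim
      fix x assume l: "(\<lambda>i. s i x) \<longlonglongrightarrow> f x" and x: "x \<in> space M"
      have l0: "(\<lambda>i. norm (f x - s i x)) \<longlonglongrightarrow> 0"
        using tendsto_norm[OF tendsto_diff[OF tendsto_const l, of "f x"]] by simp
      then have "\<forall>\<^sub>F i in sequentially. norm (f x - s i x) < 1"
        by (rule order_tendstoD) auto
      then have "\<forall>\<^sub>F i in sequentially. norm (f x - s i x) = norm (f x - s' i x)"
        by eventually_elim
           (use x in \<open>auto simp: s'_def A_def indicator_def intro: order_trans[OF less_imp_le]\<close>)
      then have "(\<lambda>i. norm (f x - s' i x)) \<longlonglongrightarrow> 0"
        using l0 by (rule Lim_transform_eventually[rotated])
      then show "(\<lambda>i. ennreal (norm (f x - s' i x))) \<longlonglongrightarrow> 0"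
        using tendsto_ennrealI by fastforce
    qed
  qed auto
  then show ?thesis using that[of s'] bi m' by auto
qed

lemma bochner_integral_exists:
  fixes f :: "'a \<Rightarrow> 'b::banach"
  assumes "complete_measure M" "finite_measure M"
    and f: "strongly_measurable M f" and fin: "(\<integral>\<^sup>+ x. ennreal (norm (f x)) \<partial>M) < \<infinity>"
  shows "\<exists>x. has_vector_bochner_integral M f x"
proof -
  obtain s where s: "\<And>i::nat. Bochner_Integration.simple_bochner_integrable M (s i)"
    and m[measurable]: "\<And>i. (\<lambda>x. norm (f x - s i x)) \<in> borel_measurable M"
    and lim: "(\<lambda>i. \<integral>\<^sup>+ x. ennreal (norm (f x - s i x)) \<partial>M) \<longlonglongrightarrow> 0"
    using simple_L1_approximation[OF assms] by blast
  have bd: "ennreal (norm (Bochner_Integration.simple_bochner_integral M (s i) -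
        Bochner_Integration.simple_bochner_integral M (s j)))
      \<le> (\<integral>\<^sup>+ x. ennreal (norm (f x - s i x)) \<partial>M) + (\<integral>\<^sup>+ x. ennreal (norm (f x - s j x)) \<partial>M)" for i j
  proof -
    let ?I = "Bochner_Integration.simple_bochner_integral M"
    note c2 = Bochner_Integration.simple_bochner_integrable_compose2
    have "norm (?I (s i) - ?I (s j)) = norm (?I (\<lambda>x. s i x - s j x))"
      using s by (subst Bochner_Integration.simple_bochner_integral_diff) auto
    also have "\<dots> \<le> ?I (\<lambda>x. norm (s i x - s j x))"
      using c2[of "(-)" M "s i" "s j"] s
      by (auto intro!: Bochner_Integration.simple_bochner_integral_norm_bound)
    finally have "ennreal (norm (?I (s i) - ?I (s j))) \<le> ennreal (?I (\<lambda>x. norm (s i x - s j x)))"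
      by (rule ennreal_leI)
    also have "\<dots> = (\<integral>\<^sup>+x. norm (s i x - s j x) \<partial>M)"
      using c2[of "\<lambda>x y. norm (x - y)" M "s i" "s j"] s
      by (auto intro!: Bochner_Integration.simple_bochner_integral_eq_nn_integral)
    also have "\<dots> \<le> (\<integral>\<^sup>+x. ennreal (norm (f x - s i x)) + ennreal (norm (f x - s j x)) \<partial>M)"
    proof (rule nn_integral_mono)
      fix x
      have "norm (s i x - s j x) \<le> norm (f x - s i x) + norm (f x - s j x)"
        by (metis norm_diff_triangle_le norm_minus_commute order_refl)
      then show "ennreal (norm (s i x - s j x))
          \<le> ennreal (norm (f x - s i x)) + ennreal (norm (f x - s j x))"
        by (simp add: ennreal_plus[symmetric] del: ennreal_plus)
    qed
    also have "\<dots> = (\<integral>\<^sup>+ x. ennreal (norm (f x - s i x)) \<partial>M) + (\<integral>\<^sup>+ x. ennreal (norm (f x - s j x)) \<partial>M)"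
      by (rule nn_integral_add) auto
    finally show ?thesis .
  qed
  have "Cauchy (\<lambda>i. Bochner_Integration.simple_bochner_integral M (s i))"
  proof (rule metric_CauchyI)
    fix e :: real assume "e > 0"
    then have "\<forall>\<^sub>F i in sequentially. (\<integral>\<^sup>+ x. ennreal (norm (f x - s i x)) \<partial>M) < ennreal (e/2)"
      by (intro order_tendstoD(2)[OF lim]) simp
    then obtain N where N: "\<And>i. i \<ge> N \<Longrightarrow> (\<integral>\<^sup>+ x. ennreal (norm (f x - s i x)) \<partial>M) < ennreal (e/2)"
      unfolding eventually_sequentially by blast
    show "\<exists>N. \<forall>i\<ge>N. \<forall>j\<ge>N. dist (Bochner_Integration.simple_bochner_integral M (s i))
        (Bochner_Integration.simple_bochner_integral M (s j)) < e"
    proof (intro exI allI impI)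
      fix i j assume "i \<ge> N" "j \<ge> N"
      have "ennreal (norm (Bochner_Integration.simple_bochner_integral M (s i) -
        Bochner_Integration.simple_bochner_integral M (s j))) < ennreal (e/2) + ennreal (e/2)"
        by (rule le_less_trans[OF bd add_strict_mono]) (use N \<open>i \<ge> N\<close> \<open>j \<ge> N\<close> in auto)
      also have "\<dots> = ennreal e" using \<open>e > 0\<close> by (simp add: ennreal_plus[symmetric] del: ennreal_plus)
      finally show "dist (Bochner_Integration.simple_bochner_integral M (s i))
        (Bochner_Integration.simple_bochner_integral M (s j)) < e"
        using \<open>e > 0\<close> by (simp add: dist_norm ennreal_less_iff)
    qed
  qed
  then obtain x where "(\<lambda>i. Bochner_Integration.simple_bochner_integral M (s i)) \<longlonglongrightarrow> x"
    using Cauchy_convergent convergent_def by blast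
  then show ?thesis
    unfolding has_vector_bochner_integral_def
    using strongly_measurable_imp_borel_measurable[OF assms(1) f] s lim by blast
qed

text \<open>
  Scalar functionals turn the vector-valued integral into an ordinary integral.  All later
  identities between vector integrals are obtained by testing with \<open>\<lambda>x. x \<bullet> v\<close>, so that
  translation, splitting and change on null sets are needed for real functions only.
\<close>

lemma has_vector_bochner_integral_functional:
  fixes f :: "'a \<Rightarrow> 'b::real_normed_vector" and \<phi> :: "'b \<Rightarrow> real"
  assumes f: "has_vector_bochner_integral M f x" and \<phi>: "bounded_linear \<phi>"
  shows "has_bochner_integral M (\<lambda>t. \<phi> (f t)) (\<phi> x)"
proof -
  interpret \<phi>: bounded_linear \<phi> by fact
  obtain s where fm[measurable]: "f \<in> borel_measurable M"
    and s: "\<And>i::nat. Bochner_Integration.simple_bochner_integrable M (s i)"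
    and lim: "(\<lambda>i. \<integral>\<^sup>+ t. ennreal (norm (f t - s i t)) \<partial>M) \<longlonglongrightarrow> 0"
    and x: "(\<lambda>i. Bochner_Integration.simple_bochner_integral M (s i)) \<longlonglongrightarrow> x"
    using f unfolding has_vector_bochner_integral_def by blast
  have sf: "simple_function M (s i)" for i
    using s[of i] by (auto elim: Bochner_Integration.simple_bochner_integrable.cases)
  have m[measurable]: "(\<lambda>t. norm (f t - s i t)) \<in> borel_measurable M" for i
  proof (rule measurable_compose_countable'[where f = "\<lambda>y t. norm (f t - y)" and g = "s i" and I = "s i ` space M"])
    show "(\<lambda>t. norm (f t - y)) \<in> borel_measurable M" for y
      by (rule measurable_compose[OF fm]) (intro borel_measurable_continuous_onI continuous_intros)
    show "s i \<in> M \<rightarrow>\<^sub>M count_space (s i ` space M)" 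
      using sf[of i] by (auto simp: simple_function_def measurable_count_space_eq2)
    show "countable (s i ` space M)" using sf[of i] by (simp add: simple_function_def countable_finite)
  qed
  obtain K where K: "K > 0" "\<And>y. norm (\<phi> y) \<le> norm y * K"
    using \<phi>.pos_bounded by blast
  show ?thesis
  proof (rule has_bochner_integral.intros[where s = "\<lambda>i t. \<phi> (s i t)"])
    show "(\<lambda>t. \<phi> (f t)) \<in> borel_measurable M"
      by (rule measurable_compose[OF fm])
         (intro borel_measurable_continuous_onI \<phi>.continuous_on continuous_on_id)
    show "Bochner_Integration.simple_bochner_integrable M (\<lambda>t. \<phi> (s i t))" for i
      using s[of i] by (auto intro: Bochner_Integration.simple_bochner_integrable_compose2 \<phi>.zero)
    show "(\<lambda>i. \<integral>\<^sup>+ t. ennreal (norm (\<phi> (f t) - \<phi> (s i t))) \<partial>M) \<longlonglongrightarrow> 0"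
    proof (rule tendsto_sandwich[OF always_eventually _ tendsto_const])
      show "\<forall>i. 0 \<le> (\<integral>\<^sup>+ t. ennreal (norm (\<phi> (f t) - \<phi> (s i t))) \<partial>M)" by simp
      show "\<forall>\<^sub>F i in sequentially. (\<integral>\<^sup>+ t. ennreal (norm (\<phi> (f t) - \<phi> (s i t))) \<partial>M)
          \<le> ennreal K * (\<integral>\<^sup>+ t. ennreal (norm (f t - s i t)) \<partial>M)"
      proof (rule always_eventually, rule allI)
        fix i
        have "(\<integral>\<^sup>+ t. ennreal (norm (\<phi> (f t) - \<phi> (s i t))) \<partial>M)
            \<le> (\<integral>\<^sup>+ t. ennreal K * ennreal (norm (f t - s i t)) \<partial>M)"
        proof (rule nn_integral_mono)
          fix t
          have "norm (\<phi> (f t) - \<phi> (s i t)) \<le> K * norm (f t - s i t)"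
            using K(2)[of "f t - s i t"] by (simp add: \<phi>.diff mult.commute)
          then show "ennreal (norm (\<phi> (f t) - \<phi> (s i t))) \<le> ennreal K * ennreal (norm (f t - s i t))"
            using K(1) by (simp add: ennreal_mult[symmetric] ennreal_leI)
        qed
        also have "\<dots> = ennreal K * (\<integral>\<^sup>+ t. ennreal (norm (f t - s i t)) \<partial>M)"
          by (rule nn_integral_cmult) measurable
        finally show "(\<integral>\<^sup>+ t. ennreal (norm (\<phi> (f t) - \<phi> (s i t))) \<partial>M)
          \<le> ennreal K * (\<integral>\<^sup>+ t. ennreal (norm (f t - s i t)) \<partial>M)" .
      qed
      show "(\<lambda>i. ennreal K * (\<integral>\<^sup>+ t. ennreal (norm (f t - s i t)) \<partial>M)) \<longlonglongrightarrow> 0"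
        using ennreal_tendsto_cmult[OF _ lim, of "ennreal K"] by simp
    qed
    show "(\<lambda>i. Bochner_Integration.simple_bochner_integral M (\<lambda>t. \<phi> (s i t))) \<longlonglongrightarrow> \<phi> x"
      using \<phi>.tendsto[OF x] s
      by (simp add: Bochner_Integration.simple_bochner_integral_linear[OF \<phi>.linear_axioms])
  qed
qed

lemma has_vector_bochner_integral_weak:
  fixes f :: "real \<Rightarrow> 'b::real_normed_vector" and \<phi> :: "'b \<Rightarrow> real"
  assumes "has_vector_bochner_integral (lebesgue_on {a..b}) f x" and "bounded_linear \<phi>"
  shows "((\<lambda>t. \<phi> (f t)) has_integral \<phi> x) {a..b}"
proof -
  note h = has_vector_bochner_integral_functional[OF assms]
  have "integrable (lebesgue_on {a..b}) (\<lambda>t. \<phi> (f t))"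
    and "integral\<^sup>L (lebesgue_on {a..b}) (\<lambda>t. \<phi> (f t)) = \<phi> x"
    using h by (auto simp: integrable.simps dest: has_bochner_integral_integral_eq)
  then show ?thesis using has_integral_integral_lebesgue_on[of "{a..b}" "\<lambda>t. \<phi> (f t)"] by simp
qed

lemma AE_lebesgue_on_iff_negligible:
  fixes S :: "real set"
  assumes "S \<in> sets lebesgue"
  shows "(AE t in lebesgue_on S. P t) \<longleftrightarrow> negligible {t\<in>S. \<not> P t}"
proof -
  have "{t. \<not> (t \<in> S \<longrightarrow> P t)} = {t\<in>S. \<not> P t}" by auto
  then show ?thesis
    by (simp add: AE_lebesgue_on_iff[OF assms] completion.AE_iff_null_sets negligible_iff_null_sets)
qed

lemma has_integral_le_AE:
  fixes f g :: "real \<Rightarrow> real"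
  assumes "(f has_integral x) {a..b}" "(g has_integral y) {a..b}"
    and ae: "AE t in lebesgue_on {a..b}. f t \<le> g t"
  shows "x \<le> y"
proof -
  let ?N = "{t\<in>{a..b}. \<not> f t \<le> g t}"
  have "((\<lambda>t. if t \<in> ?N then g t else f t) has_integral x) {a..b}"
    by (rule has_integral_spike[OF _ _ assms(1)]) (use ae in \<open>auto simp: AE_lebesgue_on_iff_negligible\<close>)
  then show ?thesis by (rule has_integral_le[OF _ assms(2)]) auto
qed

text \<open>
  Testing with \<open>v = x\<close> gives \<open>norm x ^ 2 \<le> (\<integral> c) * norm x\<close>.
\<close>

lemma norm_le_weak_integral:
  fixes f :: "real \<Rightarrow> 'b::real_inner"
  assumes f: "\<And>v. ((\<lambda>t. f t \<bullet> v) has_integral x \<bullet> v) {a..b}"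
    and ae: "AE t in lebesgue_on {a..b}. norm (f t) \<le> c t"
    and c: "c integrable_on {a..b}"
  shows "norm x \<le> integral {a..b} c"
proof (cases "x = 0")
  case True
  have "0 \<le> integral {a..b} c"
    by (rule has_integral_le_AE[OF has_integral_0 integrable_integral[OF c]])
       (use ae in \<open>auto elim!: eventually_mono intro: order_trans[OF norm_ge_zero]\<close>)
  then show ?thesis using True by simp
next
  case False
  have "((\<lambda>t. c t * norm x) has_integral (integral {a..b} c * norm x)) {a..b}"
    by (intro has_integral_mult_left integrable_integral c)
  moreover have "AE t in lebesgue_on {a..b}. f t \<bullet> x \<le> c t * norm x"
    using ae
  proof eventually_elim
    fix t assume "norm (f t) \<le> c t"
    then have "norm (f t) * norm x \<le> c t * norm x" by (intro mult_right_mono) auto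
    then show "f t \<bullet> x \<le> c t * norm x"
      using norm_cauchy_schwarz[of "f t" x] by simp
  qed
  ultimately have "x \<bullet> x \<le> integral {a..b} c * norm x"
    by (intro has_integral_le_AE[OF f])
  then have "norm x * norm x \<le> integral {a..b} c * norm x"
    by (simp add: power2_norm_eq_inner[symmetric] power2_eq_square)
  then show ?thesis using False by (simp add: mult_le_cancel_right)
qed

lemma norm_diff_bochner_le:
  fixes f g :: "real \<Rightarrow> 'b::real_inner"
  assumes f: "has_vector_bochner_integral (lebesgue_on {a..b}) f x"
    and g: "has_vector_bochner_integral (lebesgue_on {a..b}) g y"
    and ae: "AE t in lebesgue_on {a..b}. norm (f t - g t) \<le> c t"
    and c: "c integrable_on {a..b}"
  shows "norm (x - y) \<le> integral {a..b} c"
proof (rule norm_le_weak_integral[OF _ ae c])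
  show "((\<lambda>t. (f t - g t) \<bullet> v) has_integral (x - y) \<bullet> v) {a..b}" for v
    unfolding inner_diff_left
    by (intro has_integral_diff has_vector_bochner_integral_weak[OF f bounded_linear_inner_left]
        has_vector_bochner_integral_weak[OF g bounded_linear_inner_left])
qed

section \<open>Finite-rank approximation below a compact operator\<close>

lemma orthogonal_projection_onto_span:
  fixes E :: "'u::real_inner set"
  assumes "finite E"
  obtains P :: "'u \<Rightarrow>\<^sub>L 'u"
  where "range P \<subseteq> span E" and "norm P \<le> 1"
    and "\<And>u. norm (u - P u) \<le> norm u" and "\<And>u z. z \<in> E \<Longrightarrow> (u - P u) \<bullet> z = 0"
proof -
  obtain C where C: "finite C" "span C = span E" "pairwise orthogonal C"
    using basis_orthogonal[OF assms] by blast
  define p where "p u = (\<Sum>c\<in>C. (u \<bullet> c / (c \<bullet> c)) *\<^sub>R c)" for u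
  have bl: "bounded_linear p"
    unfolding p_def divide_inverse
    by (intro bounded_linear_sum bounded_linear_compose[OF bounded_linear_scaleR_left]
        bounded_linear_compose[OF bounded_linear_mult_left] bounded_linear_inner_left)
  have pC: "(u - p u) \<bullet> c = 0" if c: "c \<in> C" for u c
  proof -
    have "p u \<bullet> c = (\<Sum>d\<in>C. (u \<bullet> d / (d \<bullet> d)) * (d \<bullet> c))"
      unfolding p_def by (simp add: inner_sum_left)
    also have "\<dots> = (\<Sum>d\<in>{c}. (u \<bullet> d / (d \<bullet> d)) * (d \<bullet> c))"
      using C c by (intro sum.mono_neutral_right) (auto simp: pairwise_def orthogonal_def)
    finally show ?thesis by (cases "c = 0") (auto simp: inner_diff_left)
  qed
  have pspan: "p u \<in> span E" for u
    unfolding p_def C(2)[symmetric] by (intro span_sum span_mul span_base)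
  have orth: "(u - p u) \<bullet> z = 0" if "z \<in> span E" for u z
    using that unfolding C(2)[symmetric]
    by (induction rule: span_induct_alt) (auto simp: inner_add_right pC)
  have pyth: "(norm u)\<^sup>2 = (norm (p u))\<^sup>2 + (norm (u - p u))\<^sup>2" for u
    using norm_add_Pythagorean[of "p u" "u - p u"] orth[OF pspan, of u u]
    by (simp add: orthogonal_def inner_commute)
  have np: "norm (p u) \<le> norm u" for u
    by (rule power2_le_imp_le) (use pyth[of u] in auto)
  have nq: "norm (u - p u) \<le> norm u" for u
    by (rule power2_le_imp_le) (use pyth[of u] in auto)
  show ?thesis
  proof (rule that[of "Blinfun p"])
    show "norm (Blinfun p) \<le> 1"
      using np by (intro norm_blinfun_bound) (auto simp: bounded_linear_Blinfun_apply[OF bl])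
    show "range (Blinfun p) \<subseteq> span E"
      using pspan by (auto simp: bounded_linear_Blinfun_apply[OF bl])
    show "norm (u - Blinfun p u) \<le> norm u" for u
      using nq by (simp add: bounded_linear_Blinfun_apply[OF bl])
    show "(u - Blinfun p u) \<bullet> z = 0" if "z \<in> E" for u z
      unfolding bounded_linear_Blinfun_apply[OF bl] by (rule orth[OF span_base[OF that]])
  qed
qed

text \<open>
  An almost maximizing unit vector plays the part of the Riesz representative.  If \<open>z\<close> and \<open>w\<close> are
  orthogonal unit vectors, then \<open>\<phi> z ^ 2 + \<phi> w ^ 2 \<le> (onorm \<phi>)^2\<close>, as one sees from the value of
  \<open>\<phi>\<close> at \<open>\<phi> z *\<^sub>R z + \<phi> w *\<^sub>R w\<close>.  Hence \<open>\<phi>\<close> is small on the orthogonal complement of \<open>z\<close>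
  once \<open>\<phi> z\<close> is close to the norm.
\<close>

lemma approximate_riesz_vector:
  fixes \<phi> :: "'u::real_inner \<Rightarrow> real"
  assumes bl: "bounded_linear \<phi>" and e: "\<epsilon> > 0"
  obtains z where "\<And>u. u \<bullet> z = 0 \<Longrightarrow> \<bar>\<phi> u\<bar> \<le> \<epsilon> * norm u"
proof -
  interpret bounded_linear \<phi> by fact
  define L where "L = onorm \<phi>"
  have L: "\<bar>\<phi> u\<bar> \<le> L * norm u" for u using onorm[OF bl, of u] by (simp add: L_def)
  have L0: "L \<ge> 0" using onorm_pos_le[OF bl] by (simp add: L_def)
  show ?thesis
  proof (cases "L \<le> \<epsilon>")
    case True
    then show ?thesis
      by (intro that[of 0]) (meson L mult_right_mono norm_ge_zero order_trans)
  next
    case False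
    define R where "R = sqrt (L\<^sup>2 - \<epsilon>\<^sup>2)"
    have le: "\<epsilon>\<^sup>2 \<le> L\<^sup>2" using False e by (intro power_mono) auto
    have R2: "R\<^sup>2 = L\<^sup>2 - \<epsilon>\<^sup>2" unfolding R_def using le by simp
    have "R < L" unfolding R_def using e L0 by (intro real_less_lsqrt) auto
    moreover have "L \<le> R" if "\<forall>z. \<bar>\<phi> z\<bar> \<le> R * norm z"
      unfolding L_def by (rule onorm_bound) (use that in \<open>auto simp: R_def le\<close>)
    ultimately obtain z' where z': "\<bar>\<phi> z'\<bar> > R * norm z'" by (meson not_le)
    have "z' \<noteq> 0" using z' by (auto simp: zero)
    define z where "z = z' /\<^sub>R norm z'"
    have nz: "norm z = 1" using \<open>z' \<noteq> 0\<close> by (simp add: z_def)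
    have "R < \<bar>\<phi> z\<bar>"
      using z' \<open>z' \<noteq> 0\<close> by (simp add: z_def scaleR abs_mult field_simps)
    then have pz: "L\<^sup>2 - \<epsilon>\<^sup>2 \<le> (\<phi> z)\<^sup>2"
      using R2 by (metis R_def le diff_ge_0_iff_ge less_imp_le power2_abs power_mono real_sqrt_ge_zero)
    show ?thesis
    proof (rule that[of z])
      fix u assume uz: "u \<bullet> z = 0"
      show "\<bar>\<phi> u\<bar> \<le> \<epsilon> * norm u"
      proof (cases "u = 0")
        case True then show ?thesis by (simp add: zero)
      next
        case False
        define w where "w = u /\<^sub>R norm u"
        have nw: "norm w = 1" and wz: "w \<bullet> z = 0" using False uz by (auto simp: w_def)
        let ?x = "\<phi> z *\<^sub>R z + \<phi> w *\<^sub>R w"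
        let ?A = "(\<phi> z)\<^sup>2 + (\<phi> w)\<^sup>2"
        have "(norm ?x)\<^sup>2 = (norm (\<phi> z *\<^sub>R z))\<^sup>2 + (norm (\<phi> w *\<^sub>R w))\<^sup>2"
          by (rule norm_add_Pythagorean) (use wz in \<open>auto simp: orthogonal_def inner_commute\<close>)
        then have nx: "(norm ?x)\<^sup>2 = ?A" by (simp add: nz nw)
        have "\<phi> ?x = ?A" by (simp add: add scaleR power2_eq_square)
        then have "?A \<le> L * norm ?x" using L[of ?x] by simp
        then have "?A\<^sup>2 \<le> (L * norm ?x)\<^sup>2" by (rule power_mono) simp
        then have "?A\<^sup>2 \<le> L\<^sup>2 * ?A" unfolding power_mult_distrib nx .
        then have "?A * ?A \<le> L\<^sup>2 * ?A" unfolding power2_eq_square[of ?A] .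
        then have "?A \<le> L\<^sup>2"
        proof (cases "?A = 0")
          case False
          then have "?A > 0" by (simp add: sum_power2_gt_zero_iff sum_power2_eq_zero_iff)
          then show ?thesis using \<open>?A * ?A \<le> L\<^sup>2 * ?A\<close> by (simp add: mult_le_cancel_right)
        qed simp
        then have "(\<phi> w)\<^sup>2 \<le> \<epsilon>\<^sup>2" using pz by linarith
        then have "\<bar>\<phi> w\<bar> \<le> \<epsilon>" using e by (simp add: abs_le_square_iff[symmetric])
        then show ?thesis using False by (simp add: w_def scaleR abs_mult field_simps)
      qed
    qed
  qed
qed

text \<open>
  Compactness gives a finite \<open>\<epsilon>/2\<close>-net \<open>V\<close> for the images under \<open>G D\<close> of the unit ball.  If \<open>u\<close> is
  orthogonal to the approximate Riesz vectors of all functionals \<open>\<lambda>u. G (D u) \<bullet> v\<close> with \<open>v \<in> V\<close>, then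
  \<open>x = G (D u)\<close> is almost orthogonal to the net point next to it, so \<open>x \<bullet> x\<close> is small.  Projecting
  orthogonally onto the span of these finitely many vectors leaves exactly such a \<open>u\<close>.
\<close>

lemma finite_rank_approximation:
  fixes G :: "'h::real_inner \<Rightarrow>\<^sub>L 'k::real_inner" and \<D> :: "('u::real_inner \<Rightarrow>\<^sub>L 'h) set"
  assumes G: "compact_operator G" and fin: "finite \<D>" and e: "\<epsilon> > 0"
  obtains E and P :: "'u \<Rightarrow>\<^sub>L 'u"
  where "finite E" and "range P \<subseteq> span E" and "norm P \<le> 1"
    and "\<And>u. norm (u - P u) \<le> norm u"
    and "\<And>D u. D \<in> \<D> \<Longrightarrow> norm (G (D (u - P u))) \<le> \<epsilon> * norm u"
proof -
  define X where "X = (\<Union>D\<in>\<D>. blinfun_apply D ` cball 0 1)"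
  have "bounded X" unfolding X_def
    by (intro bounded_UN fin ballI bounded_linear_image bounded_cball blinfun.bounded_linear_right)
  then have "compact (closure (G ` X))" using G unfolding compact_operator_def by blast
  then obtain V where V: "finite V" "closure (G ` X) \<subseteq> (\<Union>v\<in>V. ball v (\<epsilon>/2))"
    using e unfolding compact_eq_totally_bounded by (meson half_gt_zero)
  \<comment> \<open>Tolerance for the functionals; for a unit vector \<open>u\<close>, the norm of \<open>x = G (D u)\<close> then satisfies
    \<open>norm x ^ 2 \<le> norm x * (\<epsilon>/2) + (\<epsilon>/2) ^ 2\<close>, which forces \<open>norm x \<le> \<epsilon>\<close>.\<close>
  define \<delta> where "\<delta> = (\<epsilon>/2)\<^sup>2"
  have "\<exists>z. \<forall>u. u \<bullet> z = 0 \<longrightarrow> \<bar>G (D u) \<bullet> v\<bar> \<le> \<delta> * norm u" for D :: "'u \<Rightarrow>\<^sub>L 'h" and v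
  proof -
    have "bounded_linear (\<lambda>u. G (D u) \<bullet> v)"
      by (intro bounded_linear_compose[OF bounded_linear_inner_left]
          bounded_linear_compose[OF blinfun.bounded_linear_right] blinfun.bounded_linear_right)
    then show ?thesis
      using approximate_riesz_vector[of "\<lambda>u. G (D u) \<bullet> v" \<delta>] e by (auto simp: \<delta>_def)
  qed
  then obtain z :: "('u \<Rightarrow>\<^sub>L 'h) \<Rightarrow> 'k \<Rightarrow> 'u"
    where z: "\<And>D v u. u \<bullet> z D v = 0 \<Longrightarrow> \<bar>G (blinfun_apply D u) \<bullet> v\<bar> \<le> \<delta> * norm u"
    by metis
  define E where "E = (\<lambda>(D, v). z D v) ` (\<D> \<times> V)"
  have "finite E" unfolding E_def using fin V by simp
  then obtain P :: "'u \<Rightarrow>\<^sub>L 'u" where P: "range P \<subseteq> span E" "norm P \<le> 1"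
      "\<And>u. norm (u - P u) \<le> norm u" "\<And>u z. z \<in> E \<Longrightarrow> (u - P u) \<bullet> z = 0"
    using orthogonal_projection_onto_span by blast
  have key: "norm (G (D u)) \<le> \<epsilon> * norm u" if D: "D \<in> \<D>" and orth: "\<And>z. z \<in> E \<Longrightarrow> u \<bullet> z = 0" for D u
  proof (cases "u = 0")
    case True then show ?thesis by (simp add: blinfun.zero_right)
  next
    case False
    define w where "w = u /\<^sub>R norm u"
    have nw: "norm w = 1" using False by (simp add: w_def)
    define x where "x = G (D w)"
    have "x \<in> closure (G ` X)"
      unfolding x_def X_def using D nw by (intro subsetD[OF closure_subset]) force
    then obtain v where v: "v \<in> V" "norm (x - v) < \<epsilon>/2"
      using V(2) by (force simp: dist_norm norm_minus_commute)
    have "w \<bullet> z D v = 0" using orth[of "z D v"] D v by (auto simp: E_def w_def)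
    then have xv: "x \<bullet> v \<le> \<delta>" using z[of w D v] nw by (simp add: x_def)
    have "norm x * norm x = x \<bullet> (x - v) + x \<bullet> v"
      by (simp add: inner_diff_right power2_norm_eq_inner[symmetric] power2_eq_square)
    also have "\<dots> \<le> norm x * (\<epsilon>/2) + (\<epsilon>/2) * (\<epsilon>/2)"
    proof -
      have "x \<bullet> (x - v) \<le> norm x * norm (x - v)" by (rule norm_cauchy_schwarz)
      also have "\<dots> \<le> norm x * (\<epsilon>/2)" using v by (intro mult_left_mono) auto
      finally show ?thesis using xv by (simp add: \<delta>_def power2_eq_square)
    qed
    finally have q: "norm x * norm x \<le> norm x * (\<epsilon>/2) + (\<epsilon>/2) * (\<epsilon>/2)" .
    have "norm x \<le> \<epsilon>"
    proof (rule ccontr)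
      assume "\<not> norm x \<le> \<epsilon>"
      then have "norm x * (norm x - \<epsilon>/2) > \<epsilon> * (\<epsilon>/2)" using e by (intro mult_strict_mono) auto
      moreover have "\<epsilon> * (\<epsilon>/2) \<ge> (\<epsilon>/2) * (\<epsilon>/2)" using e by simp
      ultimately show False using q by (simp add: right_diff_distrib)
    qed
    then show ?thesis
      using False by (simp add: x_def w_def blinfun.scaleR_right field_simps)
  qed
  show ?thesis
  proof (rule that[OF \<open>finite E\<close> P(1-3)])
    fix D u assume D: "D \<in> \<D>"
    have "norm (G (D (u - P u))) \<le> \<epsilon> * norm (u - P u)"
      by (rule key[OF D]) (rule P(4))
    also have "\<dots> \<le> \<epsilon> * norm u" using e P(3) by (intro mult_left_mono) auto
    finally show "norm (G (D (u - P u))) \<le> \<epsilon> * norm u" .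
  qed
qed

section \<open>Strongly continuous semigroups\<close>

text \<open>
  The sets of points at which some \<open>F k\<close> exceeds \<open>m\<close> are open, and no point lies in all of them.  By
  Baire one of them misses a ball, and on that ball the family is bounded by \<open>m\<close>.
\<close>

lemma uniform_boundedness_principle:
  fixes F :: "nat \<Rightarrow> 'a::banach \<Rightarrow>\<^sub>L 'b::real_normed_vector"
  assumes "\<And>x. bounded (range (\<lambda>n. F n x))"
  shows "\<exists>M. \<forall>n. norm (F n) \<le> M"
proof -
  define V where "V m = {x. \<exists>k. norm (F k x) > real m}" for m :: nat
  have open_V: "open (V m)" for m
  proof -
    have "V m = (\<Union>k. {x. norm (F k x) > real m})" by (auto simp: V_def)
    moreover have "open {x. norm (F k x) > real m}" for k
      by (intro open_Collect_less continuous_intros)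
    ultimately show ?thesis by auto
  qed
  have "\<Inter>(range V) = {}"
  proof (rule ccontr)
    assume "\<Inter>(range V) \<noteq> {}"
    then obtain x where x: "\<And>m. x \<in> V m" by auto
    obtain C where "\<And>n. norm (F n x) \<le> C" using assms[of x] unfolding bounded_iff by auto
    moreover obtain m where "C \<le> real m" using real_arch_simple by blast
    ultimately show False using x[of m] unfolding V_def by (force dest: less_le_trans)
  qed
  then have "\<not> (\<forall>m. closure (V m) = UNIV)"
    using Baire_category[of "euclidean :: 'a topology" "range V"] completely_metrizable_space_euclidean[where 'a='a] open_V
    by auto
  then obtain m x0 where "x0 \<notin> closure (V m)" by auto
  then obtain r where r: "r > 0" "ball x0 r \<inter> V m = {}"
    unfolding closure_approachable by (force simp: dist_commute)
  have "norm (F n) \<le> 4 * real m / r" for n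
  proof (rule norm_blinfun_bound)
    show "0 \<le> 4 * real m / r" using r by simp
    fix x
    show "norm (F n x) \<le> 4 * real m / r * norm x"
    proof (cases "x = 0")
      case False
      define w where "w = (r / (2 * norm x)) *\<^sub>R x"
      have nw: "norm w < r" using r False by (simp add: w_def)
      have "x0 + w \<in> ball x0 r" "x0 \<in> ball x0 r" using nw r by (auto simp: dist_norm)
      then have "x0 + w \<notin> V m" "x0 \<notin> V m" using r(2) by blast+
      then have "norm (F n (x0 + w)) \<le> real m" "norm (F n x0) \<le> real m"
        unfolding V_def by (auto simp: not_less)
      then have "norm (F n w) \<le> 2 * real m"
        using norm_triangle_ineq4[of "F n (x0 + w)" "F n x0"] by (simp add: blinfun.add_right)
      then show ?thesis using r False by (simp add: w_def blinfun.scaleR_right field_simps)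
    qed (simp add: blinfun.zero_right)
  qed
  then show ?thesis by blast
qed

text \<open>
  If the norms were unbounded near \<open>0\<close>, they would be unbounded along a sequence tending to \<open>0\<close>,
  which strong continuity at \<open>0\<close> and uniform boundedness exclude.  The semigroup law carries the
  bound from a short interval to any bounded one.
\<close>

lemma C0_semigroup_bounded:
  fixes S :: "real \<Rightarrow> 'h::banach \<Rightarrow>\<^sub>L 'h"
  assumes S: "C0_semigroup S"
  obtains M where "M \<ge> 1" "\<And>t. 0 \<le> t \<Longrightarrow> t \<le> a \<Longrightarrow> norm (S t) \<le> M"
proof -
  have add: "S (s + t) = S s o\<^sub>L S t" if "s \<ge> 0" "t \<ge> 0" for s t
    using S that unfolding C0_semigroup_def by blast
  have S0: "S 0 = id_blinfun" and lim: "((\<lambda>t. S t x) \<longlongrightarrow> x) (at_right 0)" for x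
    using S unfolding C0_semigroup_def by auto
  have "\<exists>\<delta>>0. \<exists>M. \<forall>t\<in>{0..\<delta>}. norm (S t) \<le> M"
  proof (rule ccontr)
    assume neg: "\<not> ?thesis"
    have "\<exists>t. 0 \<le> t \<and> t \<le> 1 / real (Suc n) \<and> norm (S t) > real n" for n
      using neg[simplified, rule_format, of "1 / real (Suc n)" "real n"] by (auto simp: not_le)
    then obtain t where t: "\<And>n. 0 \<le> t n" "\<And>n. t n \<le> 1 / real (Suc n)" "\<And>n. norm (S (t n)) > real n"
      by metis
    have t0: "t \<longlonglongrightarrow> 0"
      by (rule tendsto_sandwich[OF always_eventually always_eventually tendsto_const LIMSEQ_Suc[OF lim_1_over_n]])
         (use t in auto)
    have "bounded (range (\<lambda>n. S (t n) x))" for x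
    proof -
      have "((\<lambda>t. S t x) \<longlongrightarrow> S 0 x) (at 0 within {0..})"
        using lim[of x] by (simp add: S0 at_within_Ici_at_right)
      then have "continuous (at 0 within {0..}) (\<lambda>t. S t x)" by (simp add: continuous_within)
      then have "(\<lambda>n. S (t n) x) \<longlonglongrightarrow> S 0 x"
        using t0 t(1) unfolding continuous_within_sequentially by (auto simp: comp_def)
      then show ?thesis by (intro convergent_imp_bounded)
    qed
    then obtain M where M: "\<And>n. norm (S (t n)) \<le> M"
      using uniform_boundedness_principle[of "\<lambda>n. S (t n)"] by blast
    obtain n where "M \<le> real n" using real_arch_simple by blast
    then show False using M[of n] t(3)[of n] by simp
  qed
  then obtain \<delta> M0 where \<delta>: "\<delta> > 0" and M0: "\<And>t. t \<in> {0..\<delta>} \<Longrightarrow> norm (S t) \<le> M0" by blast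
  define M where "M = max 1 M0"
  have M: "M \<ge> 1" "\<And>t. t \<in> {0..\<delta>} \<Longrightarrow> norm (S t) \<le> M"
    using M0 unfolding M_def by force+
  have iter: "\<forall>t. 0 \<le> t \<and> t \<le> real n * \<delta> \<longrightarrow> norm (S t) \<le> M ^ Suc n" for n
  proof (induction n)
    case 0
    show ?case using M \<delta> by (auto simp: S0)
  next
    case (Suc n)
    show ?case
    proof (intro allI impI)
      fix t assume t: "0 \<le> t \<and> t \<le> real (Suc n) * \<delta>"
      show "norm (S t) \<le> M ^ Suc (Suc n)"
      proof (cases "t \<le> \<delta>")
        case True
        then have "norm (S t) \<le> M" using M t by auto
        also have "\<dots> \<le> M ^ Suc (Suc n)" using M(1) power_increasing[of 1 "Suc (Suc n)" M] by simp
        finally show ?thesis .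
      next
        case False
        have "norm (S t) = norm (S \<delta> o\<^sub>L S (t - \<delta>))" using add[of \<delta> "t - \<delta>"] False \<delta> by simp
        also have "\<dots> \<le> norm (S \<delta>) * norm (S (t - \<delta>))" by (rule norm_blinfun_compose)
        also have "\<dots> \<le> M * M ^ Suc n"
          using M \<delta> Suc t False by (intro mult_mono) (auto simp: algebra_simps)
        finally show ?thesis by simp
      qed
    qed
  qed
  obtain n where n: "a \<le> real n * \<delta>"
    using \<delta> by (metis reals_Archimedean3 less_imp_le)
  show ?thesis
    by (rule that[of "M ^ Suc n"]) (use iter[of n] n M one_le_power[OF M(1)] in \<open>force simp del: power_Suc\<close>)+
qed

text \<open>
  Reflecting the semigroup to negative times gives a function that is continuous everywhere and
  can therefore be composed with strongly measurable arguments.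
\<close>

lemma C0_semigroup_jointly_continuous:
  fixes S :: "real \<Rightarrow> 'h::banach \<Rightarrow>\<^sub>L 'h"
  assumes S: "C0_semigroup S"
  shows "continuous_on UNIV (\<lambda>(t, x). S \<bar>t\<bar> x)"
proof -
  have add: "S (s + t) x = S s (S t x)" if "s \<ge> 0" "t \<ge> 0" for s t x
    using S that unfolding C0_semigroup_def by (metis blinfun_apply_blinfun_compose)
  have S0: "S 0 = id_blinfun" and lim: "((\<lambda>t. S t x) \<longlongrightarrow> x) (at_right 0)" for x
    using S unfolding C0_semigroup_def by auto
  have "isCont (\<lambda>(t, x). S \<bar>t\<bar> x) (t0, x0)" for t0 x0
  proof -
    obtain M where M: "M \<ge> 1" "\<And>t. 0 \<le> t \<Longrightarrow> t \<le> \<bar>t0\<bar> + 1 \<Longrightarrow> norm (S t) \<le> M"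
      using C0_semigroup_bounded[OF S, where a = "\<bar>t0\<bar> + 1"] by blast
    have diff: "norm (S s x0 - S t x0) \<le> M * norm (S (t - s) x0 - x0)"
      if "0 \<le> s" "s \<le> t" "s \<le> \<bar>t0\<bar> + 1" for s t
    proof -
      have "S t x0 = S s (S (t - s) x0)" using add[of s "t - s" x0] that by simp
      then have "norm (S s x0 - S t x0) = norm (S s (S (t - s) x0 - x0))"
        by (simp add: blinfun.diff_right norm_minus_commute)
      also have "\<dots> \<le> norm (S s) * norm (S (t - s) x0 - x0)" by (rule norm_blinfun)
      also have "\<dots> \<le> M * norm (S (t - s) x0 - x0)" using M(2)[of s] that by (intro mult_right_mono) auto
      finally show ?thesis .
    qed
    define b where "b p = M * norm (snd p - x0) + M * norm (S \<bar>\<bar>fst p\<bar> - \<bar>t0\<bar>\<bar> x0 - x0)" for p :: "real \<times> 'h"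
    have S_at0: "((\<lambda>t. S \<bar>t\<bar> x0) \<longlongrightarrow> x0) (nhds 0)"
    proof -
      have "((\<lambda>t. S t x0) \<longlongrightarrow> S 0 x0) (at 0 within {0..})"
        using lim[of x0] by (simp add: S0 at_within_Ici_at_right)
      then have c: "continuous (at 0 within {0..}) (\<lambda>t. S t x0)" by (simp add: continuous_within)
      have "isCont (\<lambda>t. S \<bar>t\<bar> x0) 0"
      proof (rule continuous_at_sequentiallyI)
        fix u :: "nat \<Rightarrow> real" assume "u \<longlonglongrightarrow> 0"
        then have "(\<lambda>n. \<bar>u n\<bar>) \<longlonglongrightarrow> 0" by (rule tendsto_rabs_zero)
        then show "(\<lambda>n. S \<bar>u n\<bar> x0) \<longlonglongrightarrow> S \<bar>0\<bar> x0"
          using c unfolding continuous_within_sequentially by (auto simp: comp_def)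
      qed
      then have "((\<lambda>t. S \<bar>t\<bar> x0) \<longlongrightarrow> S \<bar>0\<bar> x0) (nhds 0)"
        using tendsto_at_iff_tendsto_nhds[of "\<lambda>t. S \<bar>t\<bar> x0" 0] by (simp add: isCont_def)
      then show ?thesis by (simp add: S0)
    qed
    have inner: "((\<lambda>p::real \<times> 'h. \<bar>fst p\<bar> - \<bar>t0\<bar>) \<longlongrightarrow> 0) (at (t0, x0))"
    proof -
      have "((\<lambda>p::real \<times> 'h. \<bar>fst p\<bar> - \<bar>t0\<bar>) \<longlongrightarrow> \<bar>fst (t0, x0)\<bar> - \<bar>t0\<bar>) (at (t0, x0))"
        by (intro tendsto_intros)
      then show ?thesis by simp
    qed
    have "(b \<longlongrightarrow> M * norm (x0 - x0) + M * norm (x0 - x0)) (at (t0, x0))"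
    proof -
      have "((\<lambda>p::real \<times> 'h. snd p) \<longlongrightarrow> snd (t0, x0)) (at (t0, x0))" by (intro tendsto_intros)
      then have 1: "((\<lambda>p::real \<times> 'h. snd p) \<longlongrightarrow> x0) (at (t0, x0))" by simp
      show ?thesis unfolding b_def
        by (intro tendsto_intros 1 filterlim_compose[OF S_at0 inner])
    qed
    then have b0: "(b \<longlongrightarrow> 0) (at (t0, x0))" by simp
    have ev: "\<forall>\<^sub>F p in at (t0, x0). norm ((case p of (t, x) \<Rightarrow> S \<bar>t\<bar> x) - S \<bar>t0\<bar> x0) \<le> b p"
    proof -
      have "\<forall>\<^sub>F p in at (t0, x0). \<bar>fst p\<bar> - \<bar>t0\<bar> < 1"
        using order_tendstoD(2)[OF inner, of 1] by simp
      then show ?thesis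
      proof eventually_elim
        fix p :: "real \<times> 'h" assume p: "\<bar>fst p\<bar> - \<bar>t0\<bar> < 1"
        obtain t x where tx: "p = (t, x)" by (cases p)
        have 1: "norm (S \<bar>t\<bar> (x - x0)) \<le> M * norm (x - x0)"
          using M(2)[of "\<bar>t\<bar>"] p tx
          by (intro order_trans[OF norm_blinfun] mult_right_mono) auto
        have 2: "norm (S \<bar>t\<bar> x0 - S \<bar>t0\<bar> x0) \<le> M * norm (S \<bar>\<bar>t\<bar> - \<bar>t0\<bar>\<bar> x0 - x0)"
        proof (cases "\<bar>t\<bar> \<le> \<bar>t0\<bar>")
          case True
          then show ?thesis using diff[of "\<bar>t\<bar>" "\<bar>t0\<bar>"] by (simp add: abs_minus_commute)
        next
          case False
          then show ?thesis using diff[of "\<bar>t0\<bar>" "\<bar>t\<bar>"] by (simp add: norm_minus_commute)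
        qed
        have "S \<bar>t\<bar> x - S \<bar>t0\<bar> x0 = S \<bar>t\<bar> (x - x0) + (S \<bar>t\<bar> x0 - S \<bar>t0\<bar> x0)"
          by (simp add: blinfun.diff_right)
        then have "norm (S \<bar>t\<bar> x - S \<bar>t0\<bar> x0) \<le> norm (S \<bar>t\<bar> (x - x0)) + norm (S \<bar>t\<bar> x0 - S \<bar>t0\<bar> x0)"
          by (metis norm_triangle_ineq)
        then show "norm ((case p of (t, x) \<Rightarrow> S \<bar>t\<bar> x) - S \<bar>t0\<bar> x0) \<le> b p"
          using 1 2 tx by (simp add: b_def)
      qed
    qed
    show ?thesis
      unfolding isCont_def using Lim_null_comparison[OF ev b0] by (simp add: LIM_zero_iff)
  qed
  then show ?thesis by (simp add: continuous_on_eq_continuous_at split: prod.splits) 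
qed

lemma C0_semigroup_continuous_on:
  fixes S :: "real \<Rightarrow> 'h::banach \<Rightarrow>\<^sub>L 'h"
  assumes S: "C0_semigroup S"
  shows "continuous_on {0..} (\<lambda>t. S t x)"
proof -
  have "continuous_on {0..} ((\<lambda>(t, x). S \<bar>t\<bar> x) \<circ> (\<lambda>t. (t, x)))"
    by (intro continuous_on_compose continuous_intros
        continuous_on_subset[OF C0_semigroup_jointly_continuous[OF S]]) auto
  then show ?thesis by (rule continuous_on_eq) auto
qed

section \<open>Locally integrable coefficients\<close>

lemma L1_loc_norm_absolutely_integrable:
  assumes C: "L1_loc C"
  shows "(\<lambda>s. norm (C s)) absolutely_integrable_on {0..a}"
proof (cases "a \<ge> 0")
  case True
  have sm: "strongly_measurable (lebesgue_on {0..a}) C"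
    and fin: "(\<integral>\<^sup>+ s. ennreal (norm (C s)) \<partial>lebesgue_on {0..a}) < \<infinity>"
    using C True unfolding L1_loc_def by auto
  have "strongly_measurable (lebesgue_on {0..a}) (\<lambda>s. norm (C s))"
    by (rule strongly_measurable_compose[OF sm]) (intro continuous_intros)
  then have "(\<lambda>s. norm (C s)) \<in> borel_measurable (lebesgue_on {0..a})"
    by (intro strongly_measurable_imp_borel_measurable complete_measure_lebesgue_on) auto
  then have "integrable (lebesgue_on {0..a}) (\<lambda>s. norm (C s))"
    using fin by (intro integrableI_bounded) auto
  then show ?thesis
    by (simp add: integrable_restrict_space set_integrable_def)
qed auto

lemma absolutely_integrable_mult_continuous:
  fixes c \<phi> :: "real \<Rightarrow> real"
  assumes "c absolutely_integrable_on {a..b}" and "continuous_on {a..b} \<phi>"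
  shows "(\<lambda>s. c s * \<phi> s) absolutely_integrable_on {a..b}"
proof -
  have "(\<lambda>s. \<phi> s * c s) absolutely_integrable_on {a..b}"
    using assms by (intro absolutely_integrable_bounded_measurable_product_real
        continuous_imp_measurable_on_sets_lebesgue compact_imp_bounded compact_continuous_image) auto
  then show ?thesis by (simp add: mult.commute)
qed

lemma L_infinity_bound:
  assumes "L_infinity f"
  obtains C where "C \<ge> 0" "AE t in lebesgue_on {0..}. norm (f t) \<le> C"
proof -
  obtain C where "AE t in lebesgue_on {0..}. norm (f t) \<le> C"
    using assms unfolding L_infinity_def by blast
  then have "AE t in lebesgue_on {0..}. norm (f t) \<le> max 0 C"
    by (rule eventually_mono) auto
  then show ?thesis by (intro that[of "max 0 C"]) auto
qed

lemma L_infinity_strongly_measurable: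
  assumes "L_infinity f"
  shows "strongly_measurable (lebesgue_on {0..a}) f"
  using assms unfolding L_infinity_def
  by (auto intro: strongly_measurable_restrict_subset[where S = "{0..}"])

lemma L_infinity_imp_L1_loc:
  assumes f: "L_infinity f"
  shows "L1_loc f"
  unfolding L1_loc_def
proof (intro allI impI conjI)
  fix a :: real assume "a \<ge> 0"
  show "strongly_measurable (lebesgue_on {0..a}) f"
    by (rule L_infinity_strongly_measurable[OF f])
  obtain C where "C \<ge> 0" "AE t in lebesgue_on {0..}. norm (f t) \<le> C"
    using L_infinity_bound[OF f] .
  then have "AE t in lebesgue_on {0..a}. ennreal (norm (f t)) \<le> ennreal C"
    by (auto intro!: ennreal_leI elim!: AE_lebesgue_on_subset[OF eventually_mono])
  then have "(\<integral>\<^sup>+ t. ennreal (norm (f t)) \<partial>lebesgue_on {0..a})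
      \<le> (\<integral>\<^sup>+ t. ennreal C \<partial>lebesgue_on {0..a})"
    by (rule nn_integral_mono_AE)
  also have "\<dots> < \<infinity>"
    using \<open>a \<ge> 0\<close> by (simp add: emeasure_restrict_space ennreal_mult_less_top)
  finally show "(\<integral>\<^sup>+ t. ennreal (norm (f t)) \<partial>lebesgue_on {0..a}) < \<infinity>" .
qed

lemma L1_loc_closed_loop:
  fixes B :: "real \<Rightarrow> 'h::real_normed_vector \<Rightarrow>\<^sub>L 'h" and D :: "real \<Rightarrow> 'u::real_normed_vector \<Rightarrow>\<^sub>L 'h"
  assumes B: "L1_loc B" and D: "L_infinity D" and K: "L_infinity K"
  shows "L1_loc (\<lambda>t. (D t o\<^sub>L K t) - B t)"
  unfolding L1_loc_def
proof (intro allI impI conjI)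
  fix a :: real assume a: "a \<ge> 0"
  have "strongly_measurable (lebesgue_on {0..a}) (\<lambda>t. D t o\<^sub>L K t)"
    by (rule strongly_measurable_compose2[OF L_infinity_strongly_measurable[OF D]
          L_infinity_strongly_measurable[OF K]])
       (auto simp: case_prod_beta intro!: continuous_intros bounded_bilinear.continuous_on[OF bounded_bilinear_blinfun_compose])
  then show "strongly_measurable (lebesgue_on {0..a}) (\<lambda>t. (D t o\<^sub>L K t) - B t)"
    by (rule strongly_measurable_compose2)
       (use B a in \<open>auto simp: L1_loc_def case_prod_beta intro!: continuous_intros\<close>)
  obtain d where d: "d \<ge> 0" "AE t in lebesgue_on {0..}. norm (D t) \<le> d"
    using L_infinity_bound[OF D] .
  obtain \<kappa> where \<kappa>: "\<kappa> \<ge> 0" "AE t in lebesgue_on {0..}. norm (K t) \<le> \<kappa>"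
    using L_infinity_bound[OF K] .
  have "AE t in lebesgue_on {0..}. norm ((D t o\<^sub>L K t) - B t) \<le> d * \<kappa> + norm (B t)"
    using d(2) \<kappa>(2)
  proof eventually_elim
    fix t assume "norm (D t) \<le> d" "norm (K t) \<le> \<kappa>"
    then have "norm (D t o\<^sub>L K t) \<le> d * \<kappa>"
      by (intro order_trans[OF norm_blinfun_compose] mult_mono d) auto
    then show "norm ((D t o\<^sub>L K t) - B t) \<le> d * \<kappa> + norm (B t)"
      using norm_triangle_ineq4[of "D t o\<^sub>L K t" "B t"] by linarith
  qed
  then have ae: "AE t in lebesgue_on {0..a}. norm ((D t o\<^sub>L K t) - B t) \<le> d * \<kappa> + norm (B t)"
    by (rule AE_lebesgue_on_subset) auto
  have nB: "(\<lambda>t. norm (B t)) \<in> borel_measurable (lebesgue_on {0..a})"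
    by (rule absolutely_integrable_imp_borel_measurable[OF L1_loc_norm_absolutely_integrable[OF B]]) simp
  have "(\<integral>\<^sup>+ t. ennreal (norm ((D t o\<^sub>L K t) - B t)) \<partial>lebesgue_on {0..a})
      \<le> (\<integral>\<^sup>+ t. ennreal (d * \<kappa>) + ennreal (norm (B t)) \<partial>lebesgue_on {0..a})"
    by (rule nn_integral_mono_AE, rule eventually_mono[OF ae])
       (use d \<kappa> in \<open>simp add: ennreal_plus[symmetric] ennreal_leI del: ennreal_plus\<close>)
  also have "\<dots> = (\<integral>\<^sup>+ t. ennreal (d * \<kappa>) \<partial>lebesgue_on {0..a})
      + (\<integral>\<^sup>+ t. ennreal (norm (B t)) \<partial>lebesgue_on {0..a})"
    by (rule nn_integral_add) (use nB in auto)
  also have "\<dots> < \<infinity>"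
    using B a by (simp add: L1_loc_def emeasure_restrict_space ennreal_mult_less_top)
  finally show "(\<integral>\<^sup>+ t. ennreal (norm ((D t o\<^sub>L K t) - B t)) \<partial>lebesgue_on {0..a}) < \<infinity>" .
qed

section \<open>Duhamel integrals\<close>

text \<open>
  The integrand is strongly measurable, although \<open>\<lambda>s. S (t - s)\<close> is continuous in the strong operator
  topology only, because \<open>(t, x) \<mapsto> S t x\<close> is jointly continuous.
\<close>

lemma duhamel_integral_exists:
  fixes S C :: "real \<Rightarrow> 'h::banach \<Rightarrow>\<^sub>L 'h" and z :: "real \<Rightarrow> 'h"
  assumes S: "C0_semigroup S" and C: "L1_loc C" and z: "continuous_on {0..} z" and t: "t \<ge> 0"
  shows "\<exists>x. has_vector_bochner_integral (lebesgue_on {0..t}) (\<lambda>s. S (t - s) (C s (z s))) x"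
proof (rule bochner_integral_exists)
  show "complete_measure (lebesgue_on {0..t})" by (rule complete_measure_lebesgue_on) auto
  show "finite_measure (lebesgue_on {0..t})"
    by (rule finite_measureI) (use t in \<open>simp add: emeasure_restrict_space\<close>)
  have z': "continuous_on {0..t} z" by (rule continuous_on_subset[OF z]) auto
  have "strongly_measurable (lebesgue_on {0..t}) (\<lambda>s. C s (z s))"
    by (rule strongly_measurable_compose2[OF _ strongly_measurable_continuous[OF z'], of C blinfun_apply])
       (use C t in \<open>auto simp: L1_loc_def case_prod_beta intro!: continuous_intros\<close>)
  then have "strongly_measurable (lebesgue_on {0..t}) (\<lambda>s. S \<bar>t - s\<bar> (C s (z s)))"
    by (rule strongly_measurable_compose2[OF strongly_measurable_continuous[of 0 t "\<lambda>s. t - s"] _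
          C0_semigroup_jointly_continuous[OF S], rotated]) (intro continuous_intros)
  then show "strongly_measurable (lebesgue_on {0..t}) (\<lambda>s. S (t - s) (C s (z s)))"
    by (rule strongly_measurable_cong) auto
  obtain M where M: "M \<ge> 1" "\<And>r. 0 \<le> r \<Longrightarrow> r \<le> t \<Longrightarrow> norm (S r) \<le> M"
    using C0_semigroup_bounded[OF S, where a = t] by blast
  have "bounded (z ` {0..t})"
    by (rule compact_imp_bounded[OF compact_continuous_image[OF z' compact_Icc]])
  then obtain Z where "\<forall>x\<in>z ` {0..t}. norm x \<le> Z" unfolding bounded_iff by blast
  then have Z: "norm (z s) \<le> Z" if "s \<in> {0..t}" for s using that by blast
  have Z0: "Z \<ge> 0" using Z[of 0] t by (auto intro: order_trans[OF norm_ge_zero])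
  have "(\<integral>\<^sup>+ s. ennreal (norm (S (t - s) (C s (z s)))) \<partial>lebesgue_on {0..t})
      \<le> (\<integral>\<^sup>+ s. ennreal (M * Z) * ennreal (norm (C s)) \<partial>lebesgue_on {0..t})"
  proof (rule nn_integral_mono)
    fix s assume "s \<in> space (lebesgue_on {0..t})"
    then have s: "s \<in> {0..t}" by simp
    have "norm (S (t - s) (C s (z s))) \<le> norm (S (t - s)) * (norm (C s) * norm (z s))"
      by (meson mult_left_mono norm_blinfun norm_ge_zero order_trans)
    also have "\<dots> \<le> M * (norm (C s) * Z)"
      using M Z s Z0 by (intro mult_mono) auto
    finally show "ennreal (norm (S (t - s) (C s (z s)))) \<le> ennreal (M * Z) * ennreal (norm (C s))"
      using M Z0 by (simp add: ennreal_mult[symmetric] mult_ac ennreal_leI)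
  qed
  also have "\<dots> = ennreal (M * Z) * (\<integral>\<^sup>+ s. ennreal (norm (C s)) \<partial>lebesgue_on {0..t})"
    by (rule nn_integral_cmult)
       (use absolutely_integrable_imp_borel_measurable[OF L1_loc_norm_absolutely_integrable[OF C, of t]] in auto)
  also have "\<dots> < \<infinity>"
    using C t by (simp add: L1_loc_def ennreal_mult_less_top)
  finally show "(\<integral>\<^sup>+ s. ennreal (norm (S (t - s) (C s (z s)))) \<partial>lebesgue_on {0..t}) < \<infinity>" .
qed

text \<open>
  By the semigroup law, \<open>S (t - r)\<close> maps the integral up to time \<open>r\<close> to the part over \<open>[0, r]\<close> of the
  integral up to time \<open>t\<close>.
\<close>

lemma duhamel_integral_split:
  fixes S :: "real \<Rightarrow> 'h::real_inner \<Rightarrow>\<^sub>L 'h"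
  assumes S: "C0_semigroup S" and r: "0 \<le> r" "r \<le> t"
    and X: "has_vector_bochner_integral (lebesgue_on {0..t}) (\<lambda>s. S (t - s) (g s)) X"
    and x: "has_vector_bochner_integral (lebesgue_on {0..r}) (\<lambda>s. S (r - s) (g s)) x"
  shows "((\<lambda>s. S (t - s) (g s) \<bullet> v) has_integral (X - S (t - r) x) \<bullet> v) {r..t}"
proof -
  let ?f = "\<lambda>s. S (t - s) (g s) \<bullet> v"
  have 1: "(?f has_integral X \<bullet> v) {0..t}"
    by (rule has_vector_bochner_integral_weak[OF X bounded_linear_inner_left])
  have "bounded_linear (\<lambda>x. S (t - r) x \<bullet> v)"
    by (intro bounded_linear_compose[OF bounded_linear_inner_left] blinfun.bounded_linear_right)
  then have "((\<lambda>s. S (t - r) (S (r - s) (g s)) \<bullet> v) has_integral S (t - r) x \<bullet> v) {0..r}"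
    by (rule has_vector_bochner_integral_weak[OF x])
  moreover have "S (t - r) (S (r - s) (g s)) \<bullet> v = ?f s" if "s \<in> {0..r}" for s
  proof -
    have "S ((t - r) + (r - s)) = S (t - r) o\<^sub>L S (r - s)"
      using S that r unfolding C0_semigroup_def by (metis atLeastAtMost_iff diff_ge_0_iff_ge)
    then show ?thesis by simp
  qed
  ultimately have 2: "(?f has_integral S (t - r) x \<bullet> v) {0..r}"
    by (rule has_integral_eq[rotated])
  have "?f integrable_on {r..t}"
    by (rule integrable_subinterval_real[OF has_integral_integrable[OF 1]]) (use r in auto)
  then have 3: "(?f has_integral integral {r..t} ?f) {r..t}" by (rule integrable_integral)
  have "S (t - r) x \<bullet> v + integral {r..t} ?f = X \<bullet> v"
    using has_integral_combine[OF r 2 3] 1 by (rule has_integral_unique)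
  then have "integral {r..t} ?f = (X - S (t - r) x) \<bullet> v" by (simp add: inner_diff_left)
  then show ?thesis using 3 by metis
qed

lemma duhamel_integral_increment:
  fixes S :: "real \<Rightarrow> 'h::real_inner \<Rightarrow>\<^sub>L 'h"
  assumes S: "C0_semigroup S" and r: "0 \<le> r" "r \<le> t"
    and M: "\<And>s. 0 \<le> s \<Longrightarrow> s \<le> t \<Longrightarrow> norm (S s) \<le> M"
    and X: "has_vector_bochner_integral (lebesgue_on {0..t}) (\<lambda>s. S (t - s) (g s)) X"
    and x: "has_vector_bochner_integral (lebesgue_on {0..r}) (\<lambda>s. S (r - s) (g s)) x"
    and g: "\<And>s. s \<in> {r..t} \<Longrightarrow> norm (g s) \<le> \<gamma> s" and \<gamma>: "\<gamma> integrable_on {r..t}"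
  shows "norm (X - S (t - r) x) \<le> M * integral {r..t} \<gamma>"
proof -
  have "norm (X - S (t - r) x) \<le> integral {r..t} (\<lambda>s. M * \<gamma> s)"
  proof (rule norm_le_weak_integral[OF duhamel_integral_split[OF S r X x]])
    show "AE s in lebesgue_on {r..t}. norm (S (t - s) (g s)) \<le> M * \<gamma> s"
    proof (rule AE_I2)
      fix s assume "s \<in> space (lebesgue_on {r..t})"
      then have s: "s \<in> {r..t}" by simp
      have "norm (S (t - s) (g s)) \<le> norm (S (t - s)) * norm (g s)" by (rule norm_blinfun)
      also have "\<dots> \<le> M * \<gamma> s"
        using M[of "t - s"] g[of s] s r
        by (intro mult_mono) (auto intro: order_trans[OF norm_ge_zero])
      finally show "norm (S (t - s) (g s)) \<le> M * \<gamma> s" .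
    qed
    show "(\<lambda>s. M * \<gamma> s) integrable_on {r..t}" using \<gamma> by (rule integrable_on_mult_right)
  qed
  then show ?thesis by simp
qed

lemma continuous_on_atLeast_localI:
  fixes f :: "real \<Rightarrow> 'a::topological_space"
  assumes "\<And>a. a \<ge> 0 \<Longrightarrow> continuous_on {0..a} f"
  shows "continuous_on {0..} f"
  unfolding continuous_on_eq_continuous_within
proof
  fix t :: real assume t: "t \<in> {0..}"
  have "continuous (at t within {0..t+1}) f"
    using assms[of "t + 1"] t by (simp add: continuous_on_eq_continuous_within)
  moreover have "at t within {0..t+1} = at t within {0..}"
    by (rule at_within_nhd[of t "{..<t+1}"]) auto
  ultimately show "continuous (at t within {0..}) f" by simp
qed

text \<open>
  Near \<open>t0\<close> the function \<open>V\<close> differs from the continuous function \<open>t \<mapsto> S (t - r) (V r)\<close>, with \<open>r\<close>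
  slightly smaller than \<open>t0\<close>, by at most \<open>M\<close> times the integral of \<open>\<gamma>\<close> over a short interval.
\<close>

lemma duhamel_integral_continuous:
  fixes S :: "real \<Rightarrow> 'h::{real_inner, banach} \<Rightarrow>\<^sub>L 'h"
  assumes S: "C0_semigroup S"
    and V: "\<And>t. t \<ge> 0 \<Longrightarrow>
      has_vector_bochner_integral (lebesgue_on {0..t}) (\<lambda>s. S (t - s) (g s)) (V t)"
    and g: "\<And>s. s \<ge> 0 \<Longrightarrow> norm (g s) \<le> \<gamma> s" and \<gamma>: "\<And>a. \<gamma> integrable_on {0..a}"
  shows "continuous_on {0..} V"
  unfolding continuous_on_iff
proof (intro ballI allI impI)
  fix t0 e :: real assume "t0 \<in> {0..}" and e: "e > 0"
  then have t0: "t0 \<ge> 0" by simp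
  obtain M where M: "M \<ge> 1" "\<And>t. 0 \<le> t \<Longrightarrow> t \<le> t0 + 1 \<Longrightarrow> norm (S t) \<le> M"
    using C0_semigroup_bounded[OF S, where a = "t0 + 1"] by blast
  define J where "J t = integral {0..t} \<gamma>" for t
  have "continuous_on {0..t0+1} J"
    unfolding J_def by (rule indefinite_integral_continuous_1[OF \<gamma>])
  moreover have "e / (8 * M) > 0" using e M by simp
  ultimately obtain \<eta> where \<eta>: "\<eta> > 0"
    and J: "\<And>t. t \<in> {0..t0+1} \<Longrightarrow> dist t t0 < \<eta> \<Longrightarrow> dist (J t) (J t0) < e / (8 * M)"
    using t0 unfolding continuous_on_iff by (metis atLeastAtMost_iff le_add_same_cancel1 zero_le_one)
  \<comment> \<open>The starting point \<open>r\<close> lies below \<open>t0\<close> by \<open>\<theta>\<close>, unless this would make it negative; then every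
    nonnegative \<open>t\<close> within \<open>\<theta>\<close> of \<open>t0\<close> satisfies \<open>r \<le> t\<close>.\<close>
  define \<theta> where "\<theta> = min \<eta> 1 / 2"
  have \<theta>: "\<theta> > 0" "\<theta> < \<eta>" "\<theta> < 1" using \<eta> by (auto simp: \<theta>_def)
  define r where "r = max 0 (t0 - \<theta>)"
  have r: "0 \<le> r" "r \<le> t0" "dist r t0 < \<eta>" using t0 \<theta> by (auto simp: r_def dist_real_def)
  have near: "dist (V t) (S (t - r) (V r)) \<le> e / 4"
    if t: "r \<le> t" "t < t0 + \<theta>" for t
  proof -
    have "norm (V t - S (t - r) (V r)) \<le> M * integral {r..t} \<gamma>"
    proof (rule duhamel_integral_increment[OF S r(1) t(1) _ V V])
      show "norm (S s) \<le> M" if "0 \<le> s" "s \<le> t" for s using M that t \<theta> by auto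
      show "\<gamma> integrable_on {r..t}" by (rule integrable_subinterval_real[OF \<gamma>[of t]]) (use r in auto)
    qed (use g r t in auto)
    also have "integral {r..t} \<gamma> = J t - J r"
      unfolding J_def using Henstock_Kurzweil_Integration.integral_combine[OF r(1) t(1) \<gamma>] by simp
    also have "M * (J t - J r) \<le> M * (e / (4 * M))"
    proof (rule mult_left_mono)
      have "dist t t0 < \<eta>" using t \<theta> r by (auto simp: dist_real_def r_def)
      then have "dist (J t) (J t0) < e / (8 * M)" by (rule J[rotated]) (use t r \<theta> in auto)
      moreover have "dist (J r) (J t0) < e / (8 * M)" using r(3) by (rule J[rotated]) (use t r \<theta> in auto)
      ultimately have "J t - J r < e / (8 * M) + e / (8 * M)" by (simp add: dist_real_def abs_less_iff)
      then show "J t - J r \<le> e / (4 * M)" by simp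
    qed (use M in auto)
    finally show ?thesis using M by (simp add: dist_norm)
  qed
  have "continuous_on {r..} (\<lambda>t. S (t - r) (V r))"
    by (rule continuous_on_compose2[OF C0_semigroup_continuous_on[OF S]]) (auto intro!: continuous_intros)
  then obtain d where d: "d > 0"
    and Sd: "\<And>t. t \<in> {r..} \<Longrightarrow> dist t t0 < d \<Longrightarrow> dist (S (t - r) (V r)) (S (t0 - r) (V r)) < e / 4"
    using r(2) e unfolding continuous_on_iff by (metis atLeast_iff divide_pos_pos zero_less_numeral)
  show "\<exists>d>0. \<forall>t\<in>{0..}. dist t t0 < d \<longrightarrow> dist (V t) (V t0) < e"
  proof (intro exI[of _ "min d \<theta>"] conjI ballI impI)
    fix t assume t: "t \<in> {0..}" "dist t t0 < min d \<theta>"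
    then have rt: "r \<le> t" "t < t0 + \<theta>" by (auto simp: r_def dist_real_def)
    have "dist (V t) (V t0) \<le> dist (V t) (S (t - r) (V r))
        + dist (S (t - r) (V r)) (S (t0 - r) (V r)) + dist (V t0) (S (t0 - r) (V r))"
      using dist_triangle[of "V t" "V t0" "S (t - r) (V r)"]
        dist_triangle2[of "S (t - r) (V r)" "V t0" "S (t0 - r) (V r)"] by linarith
    then show "dist (V t) (V t0) < e"
      using near[OF rt] near[OF r(2)] Sd[of t] rt t \<theta> e by auto
  qed (use d \<theta> in auto)
qed

section \<open>Weighted estimates for integrable kernels\<close>

text \<open>
  Split \<open>c\<close> into a part bounded by \<open>k\<close> and a remainder with small integral.  The bounded part
  contributes at most \<open>k / \<mu> * exp (\<mu> * t)\<close>, the remainder at most its integral times \<open>exp (\<mu> * t)\<close>.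
  With the weight \<open>exp (\<mu> * t)\<close>, an integrable kernel thus acts as a strict contraction on the whole
  interval at once; the Gronwall inequality and Picard iteration below both rest on this.
\<close>

lemma exponential_weight_exists:
  fixes c :: "real \<Rightarrow> real"
  assumes c: "c absolutely_integrable_on {0..\<tau>}" and c0: "\<And>s. c s \<ge> 0" and e: "\<epsilon> > 0"
  obtains \<mu> where "\<mu> > 0"
    and "\<And>t. t \<in> {0..\<tau>} \<Longrightarrow> integral {0..t} (\<lambda>s. c s * exp (\<mu> * s)) \<le> \<epsilon> * exp (\<mu> * t)"
proof -
  define q where "q k s = max 0 (c s - real k)" for k s
  have qi: "q k absolutely_integrable_on {0..\<tau>}" for k
    unfolding q_def by (intro absolutely_integrable_max_1 set_integral_diff c) auto
  have "(\<lambda>k. integral {0..\<tau>} (q k)) \<longlonglongrightarrow> integral {0..\<tau>} (\<lambda>s. 0)"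
  proof (rule dominated_convergence(2))
    show "q k integrable_on {0..\<tau>}" for k using qi by (rule set_lebesgue_integral_eq_integral(1))
    show "c integrable_on {0..\<tau>}" using c by (rule set_lebesgue_integral_eq_integral(1))
    show "norm (q k s) \<le> c s" for k s using c0[of s] by (auto simp: q_def)
    show "(\<lambda>k. q k s) \<longlonglongrightarrow> 0" for s
    proof (rule tendsto_eventually)
      obtain n where "c s \<le> real n" using real_arch_simple by blast
      then show "\<forall>\<^sub>F k in sequentially. q k s = 0"
        unfolding eventually_sequentially q_def by (intro exI[of _ n]) auto
    qed
  qed
  then have "(\<lambda>k. integral {0..\<tau>} (q k)) \<longlonglongrightarrow> 0" by simp
  then have "\<forall>\<^sub>F k in sequentially. integral {0..\<tau>} (q k) < \<epsilon> / 2"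
    by (rule order_tendstoD) (use e in auto)
  then obtain k where k: "integral {0..\<tau>} (q k) < \<epsilon> / 2" unfolding eventually_sequentially by blast
  define \<mu> where "\<mu> = 2 * real k / \<epsilon> + 1"
  have \<mu>: "\<mu> > 0" "real k / \<mu> \<le> \<epsilon> / 2"
  proof -
    show "\<mu> > 0" using e by (simp add: \<mu>_def add_nonneg_pos)
    then show "real k / \<mu> \<le> \<epsilon> / 2" using e by (simp add: \<mu>_def field_simps)
  qed
  show ?thesis
  proof (rule that[OF \<mu>(1)])
    fix t assume t: "t \<in> {0..\<tau>}"
    have sub: "{0..t} \<subseteq> {0..\<tau>}" using t by auto
    have ct: "c absolutely_integrable_on {0..t}"
      by (rule set_integrable_subset[OF c]) (use sub in auto)
    have qt: "q k integrable_on {0..t}"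
      by (rule integrable_on_subinterval[OF set_lebesgue_integral_eq_integral(1)[OF qi] sub])
    have "((\<lambda>s. real k * exp (\<mu> * s)) has_integral
        (real k / \<mu> * exp (\<mu> * t) - real k / \<mu> * exp (\<mu> * 0))) {0..t}"
    proof (rule fundamental_theorem_of_calculus)
      show "((\<lambda>s. real k / \<mu> * exp (\<mu> * s)) has_vector_derivative real k * exp (\<mu> * s))
          (at s within {0..t})" for s
        using \<mu>(1) unfolding has_real_derivative_iff_has_vector_derivative[symmetric]
        by (auto intro!: derivative_eq_intros)
    qed (use t in auto)
    moreover have "((\<lambda>s. q k s * exp (\<mu> * t)) has_integral integral {0..t} (q k) * exp (\<mu> * t)) {0..t}"
      by (intro has_integral_mult_left integrable_integral qt)
    ultimately have "((\<lambda>s. real k * exp (\<mu> * s) + q k s * exp (\<mu> * t)) has_integral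
      (real k / \<mu> * exp (\<mu> * t) - real k / \<mu> * exp (\<mu> * 0)) + integral {0..t} (q k) * exp (\<mu> * t)) {0..t}"
      by (rule has_integral_add)
    moreover have "((\<lambda>s. c s * exp (\<mu> * s)) has_integral integral {0..t} (\<lambda>s. c s * exp (\<mu> * s))) {0..t}"
      by (intro integrable_integral set_lebesgue_integral_eq_integral(1)
          absolutely_integrable_mult_continuous[OF ct] continuous_intros)
    moreover have "c s * exp (\<mu> * s) \<le> real k * exp (\<mu> * s) + q k s * exp (\<mu> * t)" if "s \<in> {0..t}" for s
    proof -
      have "c s \<le> real k + q k s" by (auto simp: q_def)
      then have "c s * exp (\<mu> * s) \<le> (real k + q k s) * exp (\<mu> * s)" by (intro mult_right_mono) auto
      also have "\<dots> = real k * exp (\<mu> * s) + q k s * exp (\<mu> * s)" by (simp add: distrib_right)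
      also have "q k s * exp (\<mu> * s) \<le> q k s * exp (\<mu> * t)"
        using that \<mu>(1) by (intro mult_left_mono) (auto simp: q_def)
      finally show ?thesis by simp
    qed
    ultimately have "integral {0..t} (\<lambda>s. c s * exp (\<mu> * s)) \<le>
       (real k / \<mu> * exp (\<mu> * t) - real k / \<mu> * exp (\<mu> * 0)) + integral {0..t} (q k) * exp (\<mu> * t)"
      by (metis (no_types, lifting) has_integral_le)
    also have "\<dots> \<le> (real k / \<mu>) * exp (\<mu> * t) + integral {0..t} (q k) * exp (\<mu> * t)"
      using \<mu>(1) by simp
    also have "\<dots> \<le> (\<epsilon> / 2) * exp (\<mu> * t) + (\<epsilon> / 2) * exp (\<mu> * t)"
    proof (intro add_mono mult_right_mono \<mu>(2))
      have "integral {0..t} (q k) \<le> integral {0..\<tau>} (q k)"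
        by (rule integral_subset_le[OF sub qt set_lebesgue_integral_eq_integral(1)[OF qi]])
           (auto simp: q_def)
      then show "integral {0..t} (q k) \<le> \<epsilon> / 2" using k by simp
    qed auto
    also have "\<dots> = \<epsilon> * exp (\<mu> * t)" by simp
    finally show "integral {0..t} (\<lambda>s. c s * exp (\<mu> * s)) \<le> \<epsilon> * exp (\<mu> * t)" .
  qed
qed

text \<open>
  Let \<open>m\<close> be the maximum of \<open>\<phi> s * exp (- \<mu> * s)\<close>.  Inserting \<open>\<phi> s \<le> m * exp (\<mu> * s)\<close> at the
  maximizing point gives \<open>m \<le> a + m / 2\<close>.
\<close>

lemma weighted_gronwall:
  fixes c \<phi> :: "real \<Rightarrow> real"
  assumes c: "c absolutely_integrable_on {0..\<tau>}" and c0: "\<And>s. c s \<ge> 0" and \<tau>: "\<tau> \<ge> 0"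
    and \<mu>: "\<mu> \<ge> 0"
    and weight: "\<And>t. t \<in> {0..\<tau>} \<Longrightarrow> integral {0..t} (\<lambda>s. c s * exp (\<mu> * s)) \<le> 1/2 * exp (\<mu> * t)"
    and \<phi>: "continuous_on {0..\<tau>} \<phi>" and a: "a \<ge> 0"
    and le: "\<And>t. t \<in> {0..\<tau>} \<Longrightarrow> \<phi> t \<le> a + integral {0..t} (\<lambda>s. c s * \<phi> s)"
    and t: "t \<in> {0..\<tau>}"
  shows "\<phi> t \<le> 2 * a * exp (\<mu> * t)"
proof -
  have "continuous_on {0..\<tau>} (\<lambda>s. \<phi> s * exp (- (\<mu> * s)))" by (intro continuous_intros \<phi>)
  then obtain t' where t': "t' \<in> {0..\<tau>}"
    and sup: "\<And>s. s \<in> {0..\<tau>} \<Longrightarrow> \<phi> s * exp (- (\<mu> * s)) \<le> \<phi> t' * exp (- (\<mu> * t'))"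
    using continuous_attains_sup[of "{0..\<tau>}" "\<lambda>s. \<phi> s * exp (- (\<mu> * s))"] \<tau> by auto
  define m where "m = \<phi> t' * exp (- (\<mu> * t'))"
  have \<phi>m: "\<phi> s \<le> m * exp (\<mu> * s)" if "s \<in> {0..\<tau>}" for s
    using sup[OF that] by (simp add: m_def exp_minus field_simps)
  have "m \<le> 2 * a"
  proof (cases "m \<le> 0")
    case False
    have ct: "c absolutely_integrable_on {0..t'}"
      by (rule set_integrable_subset[OF c]) (use t' in auto)
    have "integral {0..t'} (\<lambda>s. c s * \<phi> s) \<le> integral {0..t'} (\<lambda>s. m * (c s * exp (\<mu> * s)))"
    proof (rule integral_le)
      show "(\<lambda>s. c s * \<phi> s) integrable_on {0..t'}"
        by (intro set_lebesgue_integral_eq_integral(1) absolutely_integrable_mult_continuous[OF ct]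
            continuous_on_subset[OF \<phi>]) (use t' in auto)
      show "(\<lambda>s. m * (c s * exp (\<mu> * s))) integrable_on {0..t'}"
        by (intro integrable_on_mult_right set_lebesgue_integral_eq_integral(1)
            absolutely_integrable_mult_continuous[OF ct] continuous_intros)
      show "c s * \<phi> s \<le> m * (c s * exp (\<mu> * s))" if "s \<in> {0..t'}" for s
        using mult_left_mono[OF \<phi>m c0, of s s] that t' by (simp add: mult_ac)
    qed
    also have "\<dots> = m * integral {0..t'} (\<lambda>s. c s * exp (\<mu> * s))" by simp
    also have "\<dots> \<le> m * (1/2 * exp (\<mu> * t'))"
      using False weight[OF t'] by (intro mult_left_mono) auto
    finally have "\<phi> t' \<le> a + m / 2 * exp (\<mu> * t')" using le[OF t'] by simp
    then have "m \<le> (a + m / 2 * exp (\<mu> * t')) * exp (- (\<mu> * t'))"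
      unfolding m_def by (intro mult_right_mono) auto
    also have "\<dots> = a * exp (- (\<mu> * t')) + m / 2"
      by (simp add: distrib_right exp_minus field_simps)
    also have "\<dots> \<le> a * 1 + m / 2"
      using a \<mu> t' by (intro add_right_mono mult_left_mono) auto
    finally show ?thesis by simp
  qed (use a in auto)
  have "\<phi> t \<le> m * exp (\<mu> * t)" by (rule \<phi>m[OF t])
  also have "\<dots> \<le> 2 * a * exp (\<mu> * t)" using \<open>m \<le> 2 * a\<close> by (intro mult_right_mono) auto
  finally show ?thesis .
qed

section \<open>Linear evolution equations with integrable coefficients\<close>

text \<open>
  For \<open>C = D K - B\<close> these are the solutions of the feedback equation.  Keeping a single locally
  integrable coefficient lets existence and time translation be treated once.
\<close>

definition evolution_solution ::
    "(real \<Rightarrow> 'h::real_normed_vector \<Rightarrow>\<^sub>L 'h) \<Rightarrow> (real \<Rightarrow> 'h \<Rightarrow>\<^sub>L 'h) \<Rightarrow> 'h \<Rightarrow> (real \<Rightarrow> 'h) \<Rightarrow> bool" where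
  "evolution_solution S C h y \<longleftrightarrow>
    continuous_on {0..} y \<and>
    (\<forall>t\<ge>0. has_vector_bochner_integral (lebesgue_on {0..t})
       (\<lambda>s. S (t - s) (C s (y s))) (y t - S t h))"

lemma feedback_solution_iff_evolution_solution:
  "feedback_solution S B D K h y \<longleftrightarrow> evolution_solution S (\<lambda>t. (D t o\<^sub>L K t) - B t) h y"
  unfolding feedback_solution_def mild_solution_def evolution_solution_def
  by (simp add: blinfun.diff_left)

text \<open>
  After the part of the integral over \<open>[0, \<tau>]\<close> is absorbed into the new initial value, the remaining
  part over \<open>[\<tau>, t + \<tau>]\<close> is translated; periodicity restores the coefficient.
\<close>

lemma evolution_solution_shift:
  fixes S C :: "real \<Rightarrow> 'h::{real_inner, banach} \<Rightarrow>\<^sub>L 'h"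
  assumes S: "C0_semigroup S" and C: "L1_loc C" and \<tau>: "\<tau> \<ge> 0" and per: "periodic_ae \<tau> C"
    and y: "evolution_solution S C h y"
  shows "evolution_solution S C (y \<tau>) (\<lambda>t. y (t + \<tau>))"
  unfolding evolution_solution_def
proof (intro conjI allI impI)
  have cy: "continuous_on {0..} y"
    and int: "\<And>t. t \<ge> 0 \<Longrightarrow> has_vector_bochner_integral (lebesgue_on {0..t})
       (\<lambda>s. S (t - s) (C s (y s))) (y t - S t h)"
    using y unfolding evolution_solution_def by auto
  show cy': "continuous_on {0..} (\<lambda>t. y (t + \<tau>))"
    by (rule continuous_on_compose2[OF cy]) (use \<tau> in \<open>auto intro!: continuous_intros\<close>)
  fix t :: real assume t: "t \<ge> 0"
  obtain x where x: "has_vector_bochner_integral (lebesgue_on {0..t}) (\<lambda>s. S (t - s) (C s (y (s + \<tau>)))) x"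
    using duhamel_integral_exists[OF S C cy' t] by blast
  have "(x - (y (t + \<tau>) - S t (y \<tau>))) \<bullet> v = 0" for v
  proof -
    have "S (t + \<tau>) = S t o\<^sub>L S \<tau>" using S t \<tau> unfolding C0_semigroup_def by auto
    then have eq: "y (t + \<tau>) - S (t + \<tau>) h - S (t + \<tau> - \<tau>) (y \<tau> - S \<tau> h) = y (t + \<tau>) - S t (y \<tau>)"
      by (simp add: blinfun.diff_right)
    have "((\<lambda>s. S (t + \<tau> - s) (C s (y s)) \<bullet> v) has_integral
        (y (t + \<tau>) - S (t + \<tau>) h - S (t + \<tau> - \<tau>) (y \<tau> - S \<tau> h)) \<bullet> v) {\<tau>..t + \<tau>}"
      by (rule duhamel_integral_split[OF S \<tau> _ int int]) (use t \<tau> in auto)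
    from has_integral_shift_real_ivl[OF this[unfolded eq], of \<tau>]
    have "((\<lambda>s. S (t - s) (C (s + \<tau>) (y (s + \<tau>))) \<bullet> v) has_integral (y (t + \<tau>) - S t (y \<tau>)) \<bullet> v) {0..t}"
      by simp
    then have "((\<lambda>s. S (t - s) (C s (y (s + \<tau>))) \<bullet> v) has_integral (y (t + \<tau>) - S t (y \<tau>)) \<bullet> v) {0..t}"
    proof (rule has_integral_spike[rotated -1])
      show "negligible {s \<in> {0..}. \<not> C (s + \<tau>) = C s}"
        using per unfolding periodic_ae_def by (subst (asm) AE_lebesgue_on_iff_negligible) auto
    qed auto
    then have "x \<bullet> v = (y (t + \<tau>) - S t (y \<tau>)) \<bullet> v"
      by (rule has_integral_unique[OF has_vector_bochner_integral_weak[OF x bounded_linear_inner_left]])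
    then show ?thesis by (simp add: inner_diff_left)
  qed
  then have "x = y (t + \<tau>) - S t (y \<tau>)" using inner_eq_zero_iff eq_iff_diff_eq_0 by blast
  then show "has_vector_bochner_integral (lebesgue_on {0..t}) (\<lambda>s. S (t - s) (C s (y (s + \<tau>))))
      (y (t + \<tau>) - S t (y \<tau>))"
    using x by simp
qed

lemma duhamel_integral_diff_le:
  fixes S C :: "real \<Rightarrow> 'h::{real_inner, banach} \<Rightarrow>\<^sub>L 'h"
  assumes M: "\<And>s. 0 \<le> s \<Longrightarrow> s \<le> t \<Longrightarrow> norm (S s) \<le> M" and C: "L1_loc C"
    and z: "continuous_on {0..} z" and w: "continuous_on {0..} w"
    and x: "has_vector_bochner_integral (lebesgue_on {0..t}) (\<lambda>s. S (t - s) (C s (z s))) x"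
    and y: "has_vector_bochner_integral (lebesgue_on {0..t}) (\<lambda>s. S (t - s) (C s (w s))) y"
  shows "norm (x - y) \<le> integral {0..t} (\<lambda>s. M * norm (C s) * norm (z s - w s))"
proof (rule norm_diff_bochner_le[OF x y])
  show "AE s in lebesgue_on {0..t}.
      norm (S (t - s) (C s (z s)) - S (t - s) (C s (w s))) \<le> M * norm (C s) * norm (z s - w s)"
  proof (rule AE_I2)
    fix s assume "s \<in> space (lebesgue_on {0..t})"
    then have s: "s \<in> {0..t}" by simp
    have "norm (S (t - s) (C s (z s)) - S (t - s) (C s (w s))) = norm (S (t - s) (C s (z s - w s)))"
      by (simp add: blinfun.diff_right)
    also have "\<dots> \<le> norm (S (t - s)) * (norm (C s) * norm (z s - w s))"
      by (meson mult_left_mono norm_blinfun norm_ge_zero order_trans)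
    also have "\<dots> \<le> M * (norm (C s) * norm (z s - w s))"
      using M s by (intro mult_right_mono) auto
    finally show "norm (S (t - s) (C s (z s)) - S (t - s) (C s (w s)))
        \<le> M * norm (C s) * norm (z s - w s)" by (simp add: mult_ac)
  qed
  show "(\<lambda>s. M * norm (C s) * norm (z s - w s)) integrable_on {0..t}"
    unfolding mult.assoc
    by (intro integrable_on_mult_right set_lebesgue_integral_eq_integral(1)
        absolutely_integrable_mult_continuous[OF L1_loc_norm_absolutely_integrable[OF C]]
        continuous_intros continuous_on_subset[OF z] continuous_on_subset[OF w]) auto
qed

text \<open>
  Picard iteration.  On \<open>[0, \<tau>]\<close> the weight \<open>exp (\<mu> * t)\<close> halves the distance of consecutive iterates
  at every step.  The iterates are defined on the whole half-line and converge uniformly on each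
  \<open>[0, \<tau>]\<close>, so local solutions never have to be glued.
\<close>

lemma evolution_solution_exists:
  fixes S C :: "real \<Rightarrow> 'h::{real_inner, banach} \<Rightarrow>\<^sub>L 'h"
  assumes S: "C0_semigroup S" and C: "L1_loc C"
  shows "\<exists>y. evolution_solution S C h y"
proof -
  define V where "V z t = (SOME x. has_vector_bochner_integral (lebesgue_on {0..t})
    (\<lambda>s. S (t - s) (C s (z s))) x)" for z t
  have V: "has_vector_bochner_integral (lebesgue_on {0..t}) (\<lambda>s. S (t - s) (C s (z s))) (V z t)"
    if "continuous_on {0..} z" "t \<ge> 0" for z t
    unfolding V_def by (rule someI_ex[OF duhamel_integral_exists[OF S C that]])
  have contV: "continuous_on {0..} (V z)" if z: "continuous_on {0..} z" for z
  proof (rule duhamel_integral_continuous[OF S V[OF z]])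
    show "norm (C s (z s)) \<le> norm (C s) * norm (z s)" for s by (rule norm_blinfun)
    show "(\<lambda>s. norm (C s) * norm (z s)) integrable_on {0..a}" for a
      by (intro set_lebesgue_integral_eq_integral(1) absolutely_integrable_mult_continuous
          L1_loc_norm_absolutely_integrable[OF C] continuous_intros continuous_on_subset[OF z]) auto
  qed
  define Y where "Y n = ((\<lambda>z t. S t h + V z t) ^^ n) (\<lambda>t. S t h)" for n
  have Y0: "Y 0 t = S t h" and YS: "Y (Suc n) t = S t h + V (Y n) t" for n t
    by (simp_all add: Y_def)
  have YS': "Y (Suc n) = (\<lambda>t. S t h + V (Y n) t)" for n using YS by blast
  have contY: "continuous_on {0..} (Y n)" for n
  proof (induction n)
    case 0
    show ?case unfolding Y_def using C0_semigroup_continuous_on[OF S] by simp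
  next
    case (Suc n)
    show ?case unfolding YS'
      by (intro continuous_intros contV[OF Suc] C0_semigroup_continuous_on[OF S])
  qed
  define u where "u n t = Y (Suc n) t - Y n t" for n t
  define y where "y t = Y 0 t + (\<Sum>n. u n t)" for t
  have unif: "uniform_limit {0..\<tau>} Y y sequentially" if \<tau>: "\<tau> \<ge> 0" for \<tau>
  proof -
    obtain M where M: "M \<ge> 1" "\<And>t. 0 \<le> t \<Longrightarrow> t \<le> \<tau> \<Longrightarrow> norm (S t) \<le> M"
      using C0_semigroup_bounded[OF S, where a = \<tau>] by blast
    define c where "c s = M * norm (C s)" for s
    have c: "c absolutely_integrable_on {0..\<tau>}"
      unfolding c_def using L1_loc_norm_absolutely_integrable[OF C]
      by (intro set_integrable_mult_right) auto
    have c0: "c s \<ge> 0" for s using M by (simp add: c_def)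
    obtain \<mu> where \<mu>: "\<mu> > 0"
      and weight: "\<And>t. t \<in> {0..\<tau>} \<Longrightarrow> integral {0..t} (\<lambda>s. c s * exp (\<mu> * s)) \<le> 1/2 * exp (\<mu> * t)"
      using exponential_weight_exists[OF c c0, of "1/2"] by auto
    have contu: "continuous_on {0..\<tau>} (u n)" for n
      unfolding u_def by (intro continuous_intros continuous_on_subset[OF contY]) auto
    have "bounded (u 0 ` {0..\<tau>})"
      by (intro compact_imp_bounded compact_continuous_image contu) auto
    then obtain m where "\<forall>x\<in>u 0 ` {0..\<tau>}. norm x \<le> m" unfolding bounded_iff by blast
    then have m: "norm (u 0 t) \<le> m" if "t \<in> {0..\<tau>}" for t using that by blast
    have m0: "m \<ge> 0" using m[of 0] \<tau> by (auto intro: order_trans[OF norm_ge_zero])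
    have ub: "\<forall>t\<in>{0..\<tau>}. norm (u n t) \<le> m * (1/2) ^ n * exp (\<mu> * t)" for n
    proof (induction n)
      case 0
      show ?case
      proof
        fix t assume t: "t \<in> {0..\<tau>}"
        have "m * 1 \<le> m * exp (\<mu> * t)" using m0 t \<mu> by (intro mult_left_mono) auto
        then show "norm (u 0 t) \<le> m * (1/2) ^ 0 * exp (\<mu> * t)" using m[OF t] by simp
      qed
    next
      case (Suc n)
      show ?case
      proof
        fix t assume t: "t \<in> {0..\<tau>}"
        have ct: "c absolutely_integrable_on {0..t}"
          by (rule set_integrable_subset[OF c]) (use t in auto)
        have "norm (u (Suc n) t) = norm (V (Y (Suc n)) t - V (Y n) t)"
          by (simp add: u_def YS)
        also have "\<dots> \<le> integral {0..t} (\<lambda>s. M * norm (C s) * norm (Y (Suc n) s - Y n s))"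
          by (rule duhamel_integral_diff_le[OF _ C contY contY V[OF contY] V[OF contY]])
             (use M t in auto)
        also have "\<dots> = integral {0..t} (\<lambda>s. c s * norm (u n s))"
          by (simp add: c_def u_def)
        also have "\<dots> \<le> integral {0..t} (\<lambda>s. m * (1/2) ^ n * (c s * exp (\<mu> * s)))"
        proof (rule integral_le)
          show "(\<lambda>s. c s * norm (u n s)) integrable_on {0..t}"
            by (intro set_lebesgue_integral_eq_integral(1) absolutely_integrable_mult_continuous[OF ct]
                continuous_intros continuous_on_subset[OF contu]) (use t in auto)
          show "(\<lambda>s. m * (1/2) ^ n * (c s * exp (\<mu> * s))) integrable_on {0..t}"
            by (intro integrable_on_mult_right set_lebesgue_integral_eq_integral(1)
                absolutely_integrable_mult_continuous[OF ct] continuous_intros)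
          show "c s * norm (u n s) \<le> m * (1/2) ^ n * (c s * exp (\<mu> * s))" if "s \<in> {0..t}" for s
          proof -
            have "norm (u n s) \<le> m * (1/2) ^ n * exp (\<mu> * s)" using Suc.IH that t by auto
            from mult_left_mono[OF this c0[of s]] show ?thesis by (simp add: mult_ac)
          qed
        qed
        also have "\<dots> = m * (1/2) ^ n * integral {0..t} (\<lambda>s. c s * exp (\<mu> * s))" by simp
        also have "\<dots> \<le> m * (1/2) ^ n * (1/2 * exp (\<mu> * t))"
          using m0 weight[OF t] by (intro mult_left_mono) auto
        finally show "norm (u (Suc n) t) \<le> m * (1/2) ^ Suc n * exp (\<mu> * t)" by simp
      qed
    qed
    have "uniform_limit {0..\<tau>} (\<lambda>n t. \<Sum>i<n. u i t) (\<lambda>t. \<Sum>i. u i t) sequentially"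
    proof (rule Weierstrass_m_test)
      show "norm (u n t) \<le> m * exp (\<mu> * \<tau>) * (1/2) ^ n" if t: "t \<in> {0..\<tau>}" for n t
      proof -
        have "norm (u n t) \<le> m * (1/2) ^ n * exp (\<mu> * t)" using ub t by blast
        also have "\<dots> \<le> m * (1/2) ^ n * exp (\<mu> * \<tau>)"
          using m0 \<mu> t by (intro mult_left_mono) auto
        finally show ?thesis by (simp add: mult_ac)
      qed
      show "summable (\<lambda>n. m * exp (\<mu> * \<tau>) * (1/2) ^ n)"
        by (intro summable_mult summable_geometric) auto
    qed
    then have "uniform_limit {0..\<tau>} (\<lambda>n t. Y 0 t + (\<Sum>i<n. u i t)) (\<lambda>t. Y 0 t + (\<Sum>i. u i t)) sequentially"
      by (intro uniform_limit_intros)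
    moreover have "Y 0 t + (\<Sum>i<n. u i t) = Y n t" for n t
      unfolding u_def by (subst sum_lessThan_telescope) simp
    ultimately show ?thesis unfolding y_def by simp
  qed
  have conty: "continuous_on {0..} y"
  proof (rule continuous_on_atLeast_localI)
    fix a :: real assume "a \<ge> 0"
    then show "continuous_on {0..a} y"
      by (intro uniform_limit_theorem[OF _ unif] always_eventually allI continuous_on_subset[OF contY]) auto
  qed
  have "has_vector_bochner_integral (lebesgue_on {0..t}) (\<lambda>s. S (t - s) (C s (y s))) (y t - S t h)"
    if t: "t \<ge> 0" for t
  proof -
    obtain M where M: "M \<ge> 1" "\<And>s. 0 \<le> s \<Longrightarrow> s \<le> t \<Longrightarrow> norm (S s) \<le> M"
      using C0_semigroup_bounded[OF S, where a = t] by blast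
    have int: "(\<lambda>s. norm (C s)) integrable_on {0..t}"
      by (rule set_lebesgue_integral_eq_integral(1)[OF L1_loc_norm_absolutely_integrable[OF C]])
    define I where "I = integral {0..t} (\<lambda>s. norm (C s))"
    have I: "I \<ge> 0" unfolding I_def by (intro integral_nonneg int) auto
    have "(\<lambda>n. V (Y n) t) \<longlonglongrightarrow> V y t"
    proof (rule LIMSEQ_I)
      fix e :: real assume e: "e > 0"
      define e' where "e' = e / (M * I + 1)"
      have MI: "M * I \<ge> 0" using M I by simp
      then have e': "e' > 0" using e by (simp add: e'_def add_nonneg_pos)
      have "\<forall>\<^sub>F n in sequentially. \<forall>s\<in>{0..t}. dist (Y n s) (y s) < e'"
        using unif[OF t] e' unfolding uniform_limit_iff by blast
      then obtain N where N: "\<And>n s. n \<ge> N \<Longrightarrow> s \<in> {0..t} \<Longrightarrow> norm (Y n s - y s) < e'"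
        unfolding eventually_sequentially dist_norm by blast
      show "\<exists>N. \<forall>n\<ge>N. norm (V (Y n) t - V y t) < e"
      proof (intro exI allI impI)
        fix n assume n: "n \<ge> N"
        have "norm (V (Y n) t - V y t) \<le> integral {0..t} (\<lambda>s. M * norm (C s) * norm (Y n s - y s))"
          by (rule duhamel_integral_diff_le[OF M(2) C contY conty V[OF contY t] V[OF conty t]])
        also have "\<dots> \<le> integral {0..t} (\<lambda>s. M * e' * norm (C s))"
        proof (rule integral_le)
          show "(\<lambda>s. M * norm (C s) * norm (Y n s - y s)) integrable_on {0..t}"
            unfolding mult.assoc
            by (intro integrable_on_mult_right set_lebesgue_integral_eq_integral(1)
                absolutely_integrable_mult_continuous[OF L1_loc_norm_absolutely_integrable[OF C]]
                continuous_intros continuous_on_subset[OF contY] continuous_on_subset[OF conty]) auto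
          show "(\<lambda>s. M * e' * norm (C s)) integrable_on {0..t}"
            by (rule integrable_on_mult_right[OF int])
          show "M * norm (C s) * norm (Y n s - y s) \<le> M * e' * norm (C s)" if "s \<in> {0..t}" for s
            using mult_left_mono[OF less_imp_le[OF N[OF n that]], of "M * norm (C s)"] M
            by (simp add: mult_ac)
        qed
        also have "\<dots> = e' * (M * I)" by (simp add: I_def)
        also have "\<dots> < e' * (M * I + 1)" using e' by simp
        also have "\<dots> = e" using MI by (simp add: e'_def)
        finally show "norm (V (Y n) t - V y t) < e" .
      qed
    qed
    moreover have "(\<lambda>n. V (Y n) t) \<longlonglongrightarrow> y t - S t h"
    proof -
      have "(\<lambda>n. Y n t) \<longlonglongrightarrow> y t" by (rule tendsto_uniform_limitI[OF unif[OF t]]) (use t in auto)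
      then have "(\<lambda>n. Y (Suc n) t - S t h) \<longlonglongrightarrow> y t - S t h"
        by (intro tendsto_intros LIMSEQ_Suc)
      then show ?thesis by (simp add: YS)
    qed
    ultimately have "V y t = y t - S t h" by (rule LIMSEQ_unique)
    then show ?thesis using V[OF conty t] by simp
  qed
  then show ?thesis using conty unfolding evolution_solution_def by blast
qed

section \<open>Stability under finite-rank truncation of the feedback\<close>

lemma L_infinity_blinfun_compose:
  fixes P :: "'u::real_normed_vector \<Rightarrow>\<^sub>L 'v::real_normed_vector"
  assumes K: "L_infinity K"
  shows "L_infinity (\<lambda>t. P o\<^sub>L K t)"
  unfolding L_infinity_def
proof
  show "strongly_measurable (lebesgue_on {0..}) (\<lambda>t. P o\<^sub>L K t)"
    using K unfolding L_infinity_def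
    by (elim conjE strongly_measurable_compose)
       (intro bounded_bilinear.continuous_on[OF bounded_bilinear_blinfun_compose] continuous_intros)
  obtain \<kappa> where \<kappa>: "\<kappa> \<ge> 0" "AE t in lebesgue_on {0..}. norm (K t) \<le> \<kappa>"
    using L_infinity_bound[OF K] .
  from \<kappa>(2) have "AE t in lebesgue_on {0..}. norm (P o\<^sub>L K t) \<le> norm P * \<kappa>"
    by eventually_elim (intro order_trans[OF norm_blinfun_compose] mult_left_mono, auto)
  then show "\<exists>\<kappa>. AE t in lebesgue_on {0..}. norm (P o\<^sub>L K t) \<le> \<kappa>" by blast
qed

lemma AE_shift:
  fixes P :: "real \<Rightarrow> bool"
  assumes ae: "AE t in lebesgue_on {0..}. P t" and \<tau>: "\<tau> \<ge> 0"
  shows "AE t in lebesgue_on {0..}. P (t + \<tau>)"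
proof -
  have "negligible {t\<in>{0..}. \<not> P t}"
    using ae AE_lebesgue_on_iff_negligible[of "{0..}" P] by simp
  then have "negligible ((+) (- \<tau>) ` {t\<in>{0..}. \<not> P t})" by (rule negligible_translation)
  moreover have "{t\<in>{0..}. \<not> P (t + \<tau>)} \<subseteq> (+) (- \<tau>) ` {t\<in>{0..}. \<not> P t}"
  proof
    fix t assume "t \<in> {t\<in>{0..}. \<not> P (t + \<tau>)}"
    then show "t \<in> (+) (- \<tau>) ` {t\<in>{0..}. \<not> P t}"
      using \<tau> by (intro image_eqI[of _ _ "t + \<tau>"]) auto
  qed
  ultimately have "negligible {t\<in>{0..}. \<not> P (t + \<tau>)}" by (rule negligible_subset)
  then show ?thesis by (subst AE_lebesgue_on_iff_negligible) auto
qed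

lemma periodic_ae_multiple:
  assumes per: "periodic_ae T f" and T: "T \<ge> 0"
  shows "periodic_ae (real n * T) f"
proof (induction n)
  case (Suc n)
  have "AE t in lebesgue_on {0..}. f (t + real n * T + T) = f (t + real n * T)"
    using AE_shift[OF per[unfolded periodic_ae_def], of "real n * T"] T by simp
  with Suc show ?case
    unfolding periodic_ae_def by eventually_elim (simp add: algebra_simps)
qed (simp add: periodic_ae_def)

lemma periodic_ae_closed_loop:
  assumes "periodic_ae T B" "periodic_ae T D" "periodic_ae T K"
  shows "periodic_ae T (\<lambda>t. (D t o\<^sub>L K t) - B t)"
  using assms unfolding periodic_ae_def by eventually_elim simp

text \<open>
  With \<open>Sr = S (t - s)\<close>, \<open>z = y s\<close> and \<open>w = y' s\<close> this compares the Duhamel integrands of the feedbacks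
  \<open>K\<close> and \<open>P K\<close>.  The first term is absorbed by the Gronwall estimate, with a kernel that is the same
  for all contractions \<open>P\<close>; in the second, the error \<open>b\<close> of the truncation meets only the given
  solution \<open>z\<close>.
\<close>

lemma feedback_truncation_integrand:
  fixes D :: "'u::real_normed_vector \<Rightarrow>\<^sub>L 'h::real_normed_vector" and Sr B :: "'h \<Rightarrow>\<^sub>L 'h"
    and K :: "'h \<Rightarrow>\<^sub>L 'u" and P :: "'u \<Rightarrow>\<^sub>L 'u"
  assumes Sr: "norm Sr \<le> M" and d: "norm D \<le> d" and \<kappa>: "norm K \<le> \<kappa>"
    and P: "norm P \<le> 1" "\<And>u. norm (u - P u) \<le> norm u"
    and z: "norm z \<le> q" and b: "\<And>u. norm (Sr (D (u - P u))) \<le> M * b * norm u"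
    and b0: "b \<ge> 0"
  shows "norm (Sr (D (P (K w)) - B w) - Sr (D (K z) - B z))
      \<le> M * (d * \<kappa> + norm B) * norm (w - z) + M * \<kappa> * q * b"
proof -
  have nn: "0 \<le> M" "0 \<le> d" "0 \<le> \<kappa>" "0 \<le> q"
    using Sr d \<kappa> z by (meson norm_ge_zero order_trans)+
  let ?v = "w - z"
  have "Sr (D (P (K w)) - B w) - Sr (D (K z) - B z)
      = Sr (D (P (K ?v)) - B ?v) - Sr (D (K z - P (K z)))"
    by (simp add: blinfun.diff_right)
  then have "norm (Sr (D (P (K w)) - B w) - Sr (D (K z) - B z))
      \<le> norm (Sr (D (P (K ?v)) - B ?v)) + norm (Sr (D (K z - P (K z))))"
    by (metis norm_triangle_ineq4)
  also have "norm (Sr (D (P (K ?v)) - B ?v)) \<le> M * (d * \<kappa> + norm B) * norm ?v"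
  proof -
    have "norm (D (P (K ?v))) \<le> norm D * norm (P (K ?v))" by (rule norm_blinfun)
    also have "\<dots> \<le> d * (\<kappa> * norm ?v)"
    proof (intro mult_mono d nn)
      have "norm (P (K ?v)) \<le> norm P * norm (K ?v)" by (rule norm_blinfun)
      also have "\<dots> \<le> 1 * (norm K * norm ?v)"
        by (intro mult_mono P norm_blinfun) auto
      also have "\<dots> \<le> \<kappa> * norm ?v" using \<kappa> by (simp add: mult_right_mono)
      finally show "norm (P (K ?v)) \<le> \<kappa> * norm ?v" .
    qed auto
    finally have "norm (D (P (K ?v)) - B ?v) \<le> d * (\<kappa> * norm ?v) + norm B * norm ?v"
      by (intro order_trans[OF norm_triangle_ineq4] add_mono norm_blinfun)
    then have "norm Sr * norm (D (P (K ?v)) - B ?v) \<le> M * (d * (\<kappa> * norm ?v) + norm B * norm ?v)"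
      using Sr nn by (intro mult_mono) auto
    then show ?thesis
      using order_trans[OF norm_blinfun] by (fastforce simp: algebra_simps)
  qed
  also have "norm (Sr (D (K z - P (K z)))) \<le> M * \<kappa> * q * b"
  proof -
    have "norm (K z) \<le> norm K * norm z" by (rule norm_blinfun)
    also have "\<dots> \<le> \<kappa> * q" using \<kappa> z nn by (intro mult_mono) auto
    finally have "M * b * norm (K z) \<le> M * b * (\<kappa> * q)" using nn b0 by (intro mult_left_mono) auto
    then show ?thesis using b[of "K z"] by (simp add: mult_ac)
  qed
  finally show ?thesis by simp
qed

text \<open>
  Although \<open>P K\<close> need not be close to \<open>K\<close> in norm, \<open>S (t - s) (D s (u - P u))\<close> is small on average in
  \<open>s\<close>, uniformly in \<open>t\<close>.  In \<open>L\<^sup>1\<close> the function \<open>D\<close> is close to a simple function \<open>D'\<close>, which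
  takes finitely many values.  If \<open>s < t - \<eta>\<close>, then \<open>S (t - s)\<close> contains the fixed compact factor
  \<open>S \<eta>\<close>, and \<open>P\<close> is chosen to make \<open>S \<eta> D' (u - P u)\<close> small for each of the values of \<open>D'\<close>.  The
  remaining interval has length \<open>\<eta>\<close>, and there the essential bound of \<open>D\<close> suffices.  Because \<open>P\<close> is a
  contraction, the Gronwall weight is fixed before the required accuracy.
\<close>

lemma finite_rank_feedback_approximation:
  fixes S :: "real \<Rightarrow> 'h::{real_inner, banach} \<Rightarrow>\<^sub>L 'h"
    and D :: "real \<Rightarrow> 'u::{real_inner, banach} \<Rightarrow>\<^sub>L 'h"
  assumes S: "C0_semigroup S" and comp: "\<And>t. t > 0 \<Longrightarrow> compact_operator (S t)"
    and B: "L1_loc B" and D: "L_infinity D" and K: "L_infinity K"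
    and \<tau>: "\<tau> > 0" and M0: "M0 \<ge> 0" and e: "\<epsilon> > 0"
  obtains E and P :: "'u \<Rightarrow>\<^sub>L 'u"
  where "finite E" and "range P \<subseteq> span E"
    and "\<And>h y y' t. \<lbrakk>feedback_solution S B D K h y;
          \<And>s. s \<in> {0..\<tau>} \<Longrightarrow> norm (y s) \<le> M0 * norm h;
          feedback_solution S B D (\<lambda>t. P o\<^sub>L K t) h y'; t \<in> {0..\<tau>}\<rbrakk>
        \<Longrightarrow> norm (y' t - y t) \<le> \<epsilon> * norm h"
proof -
  obtain M where M: "M \<ge> 1" "\<And>t. 0 \<le> t \<Longrightarrow> t \<le> \<tau> \<Longrightarrow> norm (S t) \<le> M"
    using C0_semigroup_bounded[OF S, where a = \<tau>] by blast
  obtain d where d: "d \<ge> 0" "AE t in lebesgue_on {0..}. norm (D t) \<le> d"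
    using L_infinity_bound[OF D] .
  obtain \<kappa> where \<kappa>: "\<kappa> \<ge> 0" "AE t in lebesgue_on {0..}. norm (K t) \<le> \<kappa>"
    using L_infinity_bound[OF K] .
  define c where "c s = M * (d * \<kappa> + norm (B s))" for s
  have c0: "c s \<ge> 0" for s using M d \<kappa> by (simp add: c_def)
  have c: "c absolutely_integrable_on {0..a}" for a
    unfolding c_def
    by (intro set_integrable_mult_right set_integral_add L1_loc_norm_absolutely_integrable[OF B]) auto
  obtain \<mu> where \<mu>: "\<mu> > 0"
    and weight: "\<And>t. t \<in> {0..\<tau>} \<Longrightarrow> integral {0..t} (\<lambda>s. c s * exp (\<mu> * s)) \<le> 1/2 * exp (\<mu> * t)"
    using exponential_weight_exists[OF c c0, of "1/2"] by auto
  define Q where "Q = M * \<kappa> * M0"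
  have Q: "Q \<ge> 0" using M \<kappa> M0 by (simp add: Q_def)
  \<comment> \<open>\<open>\<Lambda>\<close> is the amplification by the Gronwall estimate.  The three sources of error (replacing \<open>D\<close> by
    a simple function, truncating by \<open>P\<close>, and the interval of length \<open>\<eta>\<close>) receive \<open>\<beta>\<close> each.\<close>
  define \<Lambda> where "\<Lambda> = 2 * Q * exp (\<mu> * \<tau>)"
  have \<Lambda>: "\<Lambda> \<ge> 0" using Q by (simp add: \<Lambda>_def)
  define \<beta> where "\<beta> = \<epsilon> / (3 * (\<Lambda> + 1))"
  have \<beta>: "\<beta> > 0" "\<Lambda> * (3 * \<beta>) \<le> \<epsilon>"
    using e \<Lambda> by (auto simp: \<beta>_def field_simps)
  define \<eta> where "\<eta> = \<beta> / (d + 1)"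
  have \<eta>: "\<eta> > 0" "d * \<eta> \<le> \<beta>" using \<beta> d by (auto simp: \<eta>_def field_simps)

  have "finite_measure (lebesgue_on {0..\<tau>})"
    by (rule finite_measureI) (use \<tau> in \<open>simp add: emeasure_restrict_space\<close>)
  moreover have "complete_measure (lebesgue_on {0..\<tau>})" by (rule complete_measure_lebesgue_on) auto
  moreover have "strongly_measurable (lebesgue_on {0..\<tau>}) D"
    and "(\<integral>\<^sup>+ t. ennreal (norm (D t)) \<partial>lebesgue_on {0..\<tau>}) < \<infinity>"
    using L_infinity_imp_L1_loc[OF D] \<tau> by (auto simp: L1_loc_def)
  ultimately obtain s where s: "\<And>i::nat. Bochner_Integration.simple_bochner_integrable (lebesgue_on {0..\<tau>}) (s i)"
    and sm: "\<And>i. (\<lambda>t. norm (D t - s i t)) \<in> borel_measurable (lebesgue_on {0..\<tau>})"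
    and lim: "(\<lambda>i. \<integral>\<^sup>+ t. ennreal (norm (D t - s i t)) \<partial>lebesgue_on {0..\<tau>}) \<longlonglongrightarrow> 0"
    using simple_L1_approximation by blast
  have "\<forall>\<^sub>F i in sequentially. (\<integral>\<^sup>+ t. ennreal (norm (D t - s i t)) \<partial>lebesgue_on {0..\<tau>}) < ennreal \<beta>"
    by (rule order_tendstoD(2)[OF lim]) (use \<beta> in simp)
  then obtain i where i: "(\<integral>\<^sup>+ t. ennreal (norm (D t - s i t)) \<partial>lebesgue_on {0..\<tau>}) < ennreal \<beta>"
    unfolding eventually_sequentially by blast
  define D' where "D' = s i"
  define f where "f t = norm (D t - D' t)" for t
  have fi: "integrable (lebesgue_on {0..\<tau>}) f"
    using sm[of i] i unfolding f_def D'_def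
    by (intro integrableI_bounded) (auto elim: order.strict_trans)
  then have f: "f integrable_on {0..\<tau>}" "integral {0..\<tau>} f \<le> \<beta>"
  proof -
    have hi: "(f has_integral integral\<^sup>L (lebesgue_on {0..\<tau>}) f) {0..\<tau>}"
      by (rule has_integral_integral_lebesgue_on[OF fi]) auto
    then show "f integrable_on {0..\<tau>}" by blast
    have "ennreal (integral\<^sup>L (lebesgue_on {0..\<tau>}) f) = (\<integral>\<^sup>+ t. ennreal (f t) \<partial>lebesgue_on {0..\<tau>})"
      by (rule nn_integral_eq_integral[symmetric, OF fi]) (auto simp: f_def)
    then have "ennreal (integral\<^sup>L (lebesgue_on {0..\<tau>}) f) < ennreal \<beta>"
      using i by (simp add: f_def D'_def)
    then have "integral\<^sup>L (lebesgue_on {0..\<tau>}) f \<le> \<beta>"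
      using \<beta> by (simp add: ennreal_less_iff[OF Bochner_Integration.integral_nonneg_AE] f_def)
    then show "integral {0..\<tau>} f \<le> \<beta>" using hi by (simp add: integral_unique)
  qed
  have "finite (D' ` {0..\<tau>})"
    using s[of i] unfolding D'_def
    by (auto elim!: Bochner_Integration.simple_bochner_integrable.cases simp: simple_function_def)
  then obtain E and P :: "'u \<Rightarrow>\<^sub>L 'u" where E: "finite E" "range P \<subseteq> span E"
    and P: "norm P \<le> 1" "\<And>u. norm (u - P u) \<le> norm u"
    and small: "\<And>F u. F \<in> D' ` {0..\<tau>} \<Longrightarrow> norm (S \<eta> (blinfun_apply F (u - P u))) \<le> \<beta> / \<tau> * norm u"
    using finite_rank_approximation[OF comp[OF \<eta>(1)], of "D' ` {0..\<tau>}" "\<beta> / \<tau>"] \<beta> \<tau>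
    by (metis divide_pos_pos)
  have SD: "norm (S (t - s) (D s (u - P u))) \<le>
      M * (f s + \<beta> / \<tau> + (if s \<in> {max 0 (t - \<eta>)..t} then d else 0)) * norm u"
    if t: "t \<in> {0..\<tau>}" and s: "s \<in> {0..t}" and ds: "norm (D s) \<le> d" for t s u
  proof (cases "s \<in> {max 0 (t - \<eta>)..t}")
    case True
    have "norm (S (t - s) (D s (u - P u))) \<le> norm (S (t - s)) * (norm (D s) * norm (u - P u))"
      by (meson mult_left_mono norm_blinfun norm_ge_zero order_trans)
    also have "\<dots> \<le> M * (d * norm u)"
      using M s t ds d P(2) by (intro mult_mono) auto
    also have "\<dots> = M * d * norm u" by simp
    also have "\<dots> \<le> M * (f s + \<beta> / \<tau> + d) * norm u"
      using M \<beta> \<tau> by (intro mult_right_mono mult_left_mono) (auto simp: f_def)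
    finally show ?thesis using True by simp
  next
    case False
    then have s\<eta>: "s < t - \<eta>" using s by auto
    have "S (t - s) = S (t - s - \<eta>) o\<^sub>L S \<eta>"
      using S s\<eta> \<eta> unfolding C0_semigroup_def by (metis add.commute diff_add_cancel diff_ge_0_iff_ge less_eq_real_def less_diff_eq add_less_cancel_right)
    then have "S (t - s) (D s (u - P u)) =
        S (t - s) ((D s - D' s) (u - P u)) + S (t - s - \<eta>) (S \<eta> (D' s (u - P u)))"
      by (simp add: blinfun.diff_left blinfun.diff_right)
    then have "norm (S (t - s) (D s (u - P u))) \<le>
        norm (S (t - s) ((D s - D' s) (u - P u))) + norm (S (t - s - \<eta>) (S \<eta> (D' s (u - P u))))"
      by (metis norm_triangle_ineq)
    also have "norm (S (t - s) ((D s - D' s) (u - P u))) \<le> M * (f s * norm u)"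
    proof -
      have "norm (S (t - s) ((D s - D' s) (u - P u)))
          \<le> norm (S (t - s)) * (norm (D s - D' s) * norm (u - P u))"
        by (meson mult_left_mono norm_blinfun norm_ge_zero order_trans)
      also have "\<dots> \<le> M * (f s * norm u)"
        unfolding f_def using M s t P(2) by (intro mult_mono) auto
      finally show ?thesis .
    qed
    also have "norm (S (t - s - \<eta>) (S \<eta> (D' s (u - P u)))) \<le> M * (\<beta> / \<tau> * norm u)"
    proof -
      have "norm (S (t - s - \<eta>) (S \<eta> (D' s (u - P u))))
          \<le> norm (S (t - s - \<eta>)) * norm (S \<eta> (D' s (u - P u)))" by (rule norm_blinfun)
      also have "\<dots> \<le> M * (\<beta> / \<tau> * norm u)"
      proof (rule mult_mono)
        show "norm (S (t - s - \<eta>)) \<le> M" using M s t s\<eta> \<eta> by auto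
        show "norm (S \<eta> (D' s (u - P u))) \<le> \<beta> / \<tau> * norm u"
          by (rule small) (use s t in auto)
      qed (use M in auto)
      finally show ?thesis .
    qed
    finally show ?thesis using False by (simp only: if_False) (simp add: algebra_simps)
  qed
  show ?thesis
  proof (rule that[OF E])
    fix h y y' t
    assume y: "feedback_solution S B D K h y"
      and yb: "\<And>s. s \<in> {0..\<tau>} \<Longrightarrow> norm (y s) \<le> M0 * norm h"
      and y': "feedback_solution S B D (\<lambda>t. P o\<^sub>L K t) h y'"
      and t: "t \<in> {0..\<tau>}"
    define \<phi> where "\<phi> s = norm (y' s - y s)" for s
    have cy: "continuous_on {0..} y" and cy': "continuous_on {0..} y'"
      using y y' unfolding feedback_solution_def mild_solution_def by auto
    have c\<phi>: "continuous_on {0..a} \<phi>" for a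
      unfolding \<phi>_def
      by (intro continuous_intros continuous_on_subset[OF cy] continuous_on_subset[OF cy']) auto
    define a where "a = Q * norm h * (3 * \<beta>)"
    have le: "\<phi> r \<le> a + integral {0..r} (\<lambda>s. c s * \<phi> s)" if r: "r \<in> {0..\<tau>}" for r
    proof -
      \<comment> \<open>The truncation error \<open>b\<close> consists of the three contributions, of integral at most \<open>\<beta>\<close> each.\<close>
      define u where "u s = (if s \<in> {max 0 (r - \<eta>)..r} then d else 0)" for s
      define b where "b s = f s + \<beta> / \<tau> + u s" for s
      have "((\<lambda>s. d) has_integral d * (r - max 0 (r - \<eta>))) {max 0 (r - \<eta>)..r}"
        using has_integral_const_real[of d "max 0 (r - \<eta>)" r] r \<eta> by (auto simp: mult.commute)
      then have u: "(u has_integral d * (r - max 0 (r - \<eta>))) {0..r}"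
        unfolding u_def by (subst has_integral_restrict) auto
      have fr: "f integrable_on {0..r}"
        by (rule integrable_on_subinterval[OF f(1)]) (use r in auto)
      have "((\<lambda>s. \<beta> / \<tau>) has_integral \<beta> / \<tau> * r) {0..r}"
        using has_integral_const_real[of "\<beta> / \<tau>" 0 r] r by (simp add: mult.commute)
      from has_integral_add[OF has_integral_add[OF integrable_integral[OF fr] this] u]
      have b: "(b has_integral integral {0..r} f + \<beta> / \<tau> * r + d * (r - max 0 (r - \<eta>))) {0..r}"
        unfolding b_def .
      have b_le: "integral {0..r} b \<le> 3 * \<beta>"
      proof -
        have "integral {0..r} f \<le> integral {0..\<tau>} f"
          by (rule integral_subset_le[OF _ fr f(1)]) (use r in \<open>auto simp: f_def\<close>)
        moreover have "\<beta> / \<tau> * r \<le> \<beta> / \<tau> * \<tau>" using r \<beta> \<tau> by (intro mult_left_mono) auto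
        moreover have "d * (r - max 0 (r - \<eta>)) \<le> d * \<eta>" using d by (intro mult_left_mono) auto
        ultimately show ?thesis using b f(2) \<eta> \<tau> by (simp add: integral_unique)
      qed
      \<comment> \<open>The initial values agree, so the difference of the solutions is a difference of two integrals.\<close>
      have "norm ((y' r - S r h) - (y r - S r h)) \<le> integral {0..r} (\<lambda>s. c s * \<phi> s + Q * norm h * b s)"
      proof (rule norm_diff_bochner_le)
        show "has_vector_bochner_integral (lebesgue_on {0..r})
            (\<lambda>s. S (r - s) (D s (P (K s (y' s))) - B s (y' s))) (y' r - S r h)"
          using y' r unfolding feedback_solution_def mild_solution_def by simp
        show "has_vector_bochner_integral (lebesgue_on {0..r})
            (\<lambda>s. S (r - s) (D s (K s (y s)) - B s (y s))) (y r - S r h)"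
          using y r unfolding feedback_solution_def mild_solution_def by simp
        show "(\<lambda>s. c s * \<phi> s + Q * norm h * b s) integrable_on {0..r}"
          by (intro integrable_add integrable_on_mult_right has_integral_integrable[OF b]
              set_lebesgue_integral_eq_integral(1) absolutely_integrable_mult_continuous[OF c c\<phi>])
        have "AE s in lebesgue_on {0..r}. norm (D s) \<le> d" "AE s in lebesgue_on {0..r}. norm (K s) \<le> \<kappa>"
          using d(2) \<kappa>(2) by (auto elim!: AE_lebesgue_on_subset)
        moreover have "AE s in lebesgue_on {0..r}. s \<in> {0..r}"
          by (rule AE_I2) simp
        ultimately show "AE s in lebesgue_on {0..r}.
            norm (S (r - s) (D s (P (K s (y' s))) - B s (y' s)) - S (r - s) (D s (K s (y s)) - B s (y s)))
            \<le> c s * \<phi> s + Q * norm h * b s"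
        proof eventually_elim
          fix s assume ds: "norm (D s) \<le> d" and \<kappa>s: "norm (K s) \<le> \<kappa>" and s: "s \<in> {0..r}"
          have "norm (S (r - s)) \<le> M" "norm (y s) \<le> M0 * norm h" using M(2) yb s r by auto
          moreover have "norm (S (r - s) (D s (v - P v))) \<le> M * b s * norm v" for v
            unfolding b_def u_def by (rule SD[OF r s ds])
          moreover have "b s \<ge> 0" using \<beta> \<tau> d by (simp add: b_def u_def f_def)
          ultimately have "norm (S (r - s) (D s (P (K s (y' s))) - B s (y' s)) - S (r - s) (D s (K s (y s)) - B s (y s)))
            \<le> M * (d * \<kappa> + norm (B s)) * norm (y' s - y s) + M * \<kappa> * (M0 * norm h) * b s"
            by (intro feedback_truncation_integrand ds \<kappa>s P)
          then show "norm (S (r - s) (D s (P (K s (y' s))) - B s (y' s)) - S (r - s) (D s (K s (y s)) - B s (y s)))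
            \<le> c s * \<phi> s + Q * norm h * b s"
            by (simp add: c_def \<phi>_def Q_def mult_ac)
        qed
      qed
      also have "\<dots> = integral {0..r} (\<lambda>s. c s * \<phi> s) + Q * norm h * integral {0..r} b"
        by (subst Henstock_Kurzweil_Integration.integral_add)
           (auto intro!: set_lebesgue_integral_eq_integral(1) absolutely_integrable_mult_continuous[OF c c\<phi>]
             integrable_on_mult_right has_integral_integrable[OF b])
      also have "\<dots> \<le> integral {0..r} (\<lambda>s. c s * \<phi> s) + a"
        unfolding a_def using b_le Q by (intro add_left_mono mult_left_mono) auto
      finally show ?thesis by (simp add: \<phi>_def)
    qed
    have "\<phi> t \<le> 2 * a * exp (\<mu> * t)"
      by (rule weighted_gronwall[OF c c0 _ _ weight c\<phi> _ le t])
         (use \<tau> \<mu> Q \<beta> in \<open>auto simp: a_def\<close>)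
    also have "\<dots> \<le> 2 * a * exp (\<mu> * \<tau>)"
      using t \<mu> Q \<beta> by (intro mult_left_mono) (auto simp: a_def)
    also have "\<dots> = \<Lambda> * (3 * \<beta>) * norm h" by (simp add: a_def \<Lambda>_def)
    also have "\<dots> \<le> \<epsilon> * norm h" using \<beta>(2) by (intro mult_right_mono) auto
    finally show "norm (y' t - y t) \<le> \<epsilon> * norm h" by (simp add: \<phi>_def)
  qed
qed

text \<open>
  A period \<open>\<tau>\<close> map of norm at most \<open>1/2\<close> can be iterated because translating a solution by \<open>\<tau>\<close> gives
  a solution.  The decay rate is \<open>ln 2 / \<tau>\<close>; the factor \<open>2\<close> in the constant pays for rounding \<open>t / \<tau>\<close>
  down to an integer.
\<close>

lemma exponentially_stable_if_contracting:
  fixes S :: "real \<Rightarrow> 'h::{real_inner, banach} \<Rightarrow>\<^sub>L 'h"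
  assumes S: "C0_semigroup S" and B: "L1_loc B" and D: "L_infinity D" and K: "L_infinity K"
    and \<tau>: "\<tau> > 0" and per: "periodic_ae \<tau> (\<lambda>t. (D t o\<^sub>L K t) - B t)" and N: "N > 0"
    and bound: "\<And>h y t. feedback_solution S B D K h y \<Longrightarrow> t \<in> {0..\<tau>} \<Longrightarrow> norm (y t) \<le> N * norm h"
    and contract: "\<And>h y. feedback_solution S B D K h y \<Longrightarrow> norm (y \<tau>) \<le> 1/2 * norm h"
  shows "exponentially_stable S B D K"
proof -
  note C = L1_loc_closed_loop[OF B D K]
  have iter: "norm (y (real k * \<tau> + r)) \<le> N * (1/2) ^ k * norm h"
    if "feedback_solution S B D K h y" "r \<in> {0..\<tau>}" for k h y r
    using that
  proof (induction k arbitrary: h y)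
    case 0
    then show ?case using bound by simp
  next
    case (Suc k)
    have "feedback_solution S B D K (y \<tau>) (\<lambda>t. y (t + \<tau>))"
      using evolution_solution_shift[OF S C _ per] Suc.prems(1) \<tau>
      unfolding feedback_solution_iff_evolution_solution by auto
    from Suc.IH[OF this Suc.prems(2)]
    have "norm (y (real k * \<tau> + r + \<tau>)) \<le> N * (1/2) ^ k * norm (y \<tau>)" .
    also have "\<dots> \<le> N * (1/2) ^ k * (1/2 * norm h)"
      using N contract[OF Suc.prems(1)] by (intro mult_left_mono) auto
    finally show ?case by (simp add: algebra_simps)
  qed
  show ?thesis
    unfolding exponentially_stable_def
  proof (rule exI[of _ "2 * N"], rule conjI[rotated], rule exI[of _ "ln 2 / \<tau>"], intro conjI allI impI)
    fix h
    show "\<exists>y. feedback_solution S B D K h y"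
      unfolding feedback_solution_iff_evolution_solution by (rule evolution_solution_exists[OF S C])
    fix y t assume y: "feedback_solution S B D K h y" and t: "(0::real) \<le> t"
    define k where "k = nat \<lfloor>t / \<tau>\<rfloor>"
    define r where "r = t - real k * \<tau>"
    have k: "real k \<le> t / \<tau>" "t / \<tau> < real k + 1"
      using t \<tau> by (auto simp: k_def)
    then have "r \<in> {0..\<tau>}" using \<tau> by (auto simp: r_def field_simps)
    from iter[OF y this, of k] have "norm (y t) \<le> N * (1/2) ^ k * norm h" by (simp add: r_def)
    also have "(1/2::real) ^ k \<le> 2 * exp (- (ln 2 / \<tau>) * t)"
    proof -
      have "(1/2::real) ^ k = exp (- (ln 2)) ^ k" by (simp add: exp_minus inverse_eq_divide)
      also have "\<dots> = exp (real k * (- ln 2))" by (simp only: exp_of_nat_mult)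
      also have "\<dots> \<le> exp (ln 2 - ln 2 * (t / \<tau>))"
        using mult_left_mono[OF less_imp_le[OF k(2)], of "ln 2"] by (simp add: algebra_simps)
      also have "\<dots> = 2 * exp (- (ln 2 / \<tau>) * t)" by (simp add: exp_diff exp_minus field_simps)
      finally show ?thesis .
    qed
    finally show "norm (y t) \<le> 2 * N * exp (- (ln 2 / \<tau>) * t) * norm h"
      using N by (simp add: mult_left_mono mult_right_mono mult_ac)
  qed (use N \<tau> in auto)
qed

theorem theorem1p2:
  fixes A :: "'h::{real_inner, banach} \<Rightarrow> 'h"
    and domA :: "'h set"
    and S :: "real \<Rightarrow> 'h \<Rightarrow>\<^sub>L 'h"
    and B :: "real \<Rightarrow> 'h \<Rightarrow>\<^sub>L 'h"
    and D :: "real \<Rightarrow> 'u::{real_inner, banach} \<Rightarrow>\<^sub>L 'h"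
    and T :: real
  assumes "T > 0"
    and "generates domA (\<lambda>x. - A x) S"
    and "\<And>t. t > 0 \<Longrightarrow> compact_operator (S t)"
    and "L1_loc B" and "periodic_ae T B"
    and "L_infinity D" and "periodic_ae T D"
  shows "LPFS S B D T \<longleftrightarrow>
    (\<exists>Z. subspace Z \<and> (\<exists>E. finite E \<and> span E = Z) \<and> LPFS_wrt Z S B D T)"
proof
  assume "\<exists>Z. subspace Z \<and> (\<exists>E. finite E \<and> span E = Z) \<and> LPFS_wrt Z S B D T"
  then show "LPFS S B D T" unfolding LPFS_def LPFS_wrt_def by blast
next
  assume "LPFS S B D T"
  then obtain K :: "real \<Rightarrow> 'h \<Rightarrow>\<^sub>L 'u" where K: "L_infinity K" and perK: "periodic_ae T K"
    and "exponentially_stable S B D K"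
    unfolding LPFS_def by blast
  then obtain M \<delta> where M: "M > 0" and \<delta>: "\<delta> > 0"
    and ex: "\<And>h. \<exists>y. feedback_solution S B D K h y"
    and decay: "\<And>h y t. feedback_solution S B D K h y \<Longrightarrow> t \<ge> 0 \<Longrightarrow>
        norm (y t) \<le> M * exp (- \<delta> * t) * norm h"
    unfolding exponentially_stable_def by blast
  have S: "C0_semigroup S" using assms(2) unfolding generates_def by blast
  have bdd: "norm (y t) \<le> M * norm h" if "feedback_solution S B D K h y" "t \<ge> 0" for h y t
  proof -
    have "M * exp (- \<delta> * t) * norm h \<le> M * 1 * norm h"
      using M \<delta> that by (intro mult_right_mono mult_left_mono) auto
    then show ?thesis using decay[OF that] by simp
  qed
  \<comment> \<open>Pass to a multiple \<open>\<tau>\<close> of the period over which the given closed loop contracts by \<open>1/4\<close>.\<close>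
  have "((\<lambda>n. M * exp (- \<delta> * (real n * T))) \<longlongrightarrow> 0) sequentially"
  proof -
    have "(\<lambda>n. M * exp (- \<delta> * T) ^ n) \<longlonglongrightarrow> M * 0"
      using \<delta> assms(1) by (intro tendsto_intros LIMSEQ_realpow_zero) auto
    moreover have "exp (- \<delta> * T) ^ n = exp (- \<delta> * (real n * T))" for n
      by (simp add: exp_of_nat_mult[symmetric] mult_ac)
    ultimately show ?thesis by simp
  qed
  then have "\<forall>\<^sub>F n in sequentially. M * exp (- \<delta> * (real n * T)) < 1/4"
    by (rule order_tendstoD) simp
  then obtain n where n: "n \<ge> 1" "M * exp (- \<delta> * (real n * T)) < 1/4"
    unfolding eventually_sequentially by (metis linorder_linear)
  define \<tau> where "\<tau> = real n * T"
  have \<tau>: "\<tau> > 0" using n assms(1) by (simp add: \<tau>_def)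
  obtain E and P :: "'u \<Rightarrow>\<^sub>L 'u" where E: "finite E" "range P \<subseteq> span E"
    and close: "\<And>h y y' t. \<lbrakk>feedback_solution S B D K h y;
          \<And>s. s \<in> {0..\<tau>} \<Longrightarrow> norm (y s) \<le> M * norm h;
          feedback_solution S B D (\<lambda>t. P o\<^sub>L K t) h y'; t \<in> {0..\<tau>}\<rbrakk>
        \<Longrightarrow> norm (y' t - y t) \<le> 1/4 * norm h"
    using finite_rank_feedback_approximation[OF S assms(3,4,6) K \<tau> less_imp_le[OF M], of "1/4"]
    by (metis zero_less_divide_1_iff zero_less_numeral)
  define K' where "K' t = P o\<^sub>L K t" for t
  have K': "L_infinity K'" unfolding K'_def by (rule L_infinity_blinfun_compose[OF K])
  have perK': "periodic_ae T K'"
    using perK unfolding periodic_ae_def K'_def by eventually_elim simp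
  have near: "norm (y' t) \<le> norm (y t) + 1/4 * norm h"
    if "feedback_solution S B D K h y" "feedback_solution S B D K' h y'" "t \<in> {0..\<tau>}" for h y y' t
    using close[OF that(1) _ that(2)[unfolded K'_def] that(3)] bdd[OF that(1)]
      norm_triangle_sub[of "y' t" "y t"] by force
  have "exponentially_stable S B D K'"
  proof (rule exponentially_stable_if_contracting[OF S assms(4,6) K' \<tau>])
    show "periodic_ae \<tau> (\<lambda>t. (D t o\<^sub>L K' t) - B t)"
      unfolding \<tau>_def using assms(1)
      by (intro periodic_ae_multiple periodic_ae_closed_loop assms(5,7) perK') auto
    show "M + 1/4 > 0" using M by simp
    fix h y' assume y': "feedback_solution S B D K' h y'"
    obtain y where y: "feedback_solution S B D K h y" using ex by blast
    show "norm (y' t) \<le> (M + 1/4) * norm h" if "t \<in> {0..\<tau>}" for t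
      using near[OF y y' that] bdd[OF y, of t] that by (simp add: distrib_right)
    have "norm (y \<tau>) \<le> M * exp (- \<delta> * \<tau>) * norm h" using decay[OF y] \<tau> by simp
    also have "\<dots> \<le> 1/4 * norm h" using n(2) by (intro mult_right_mono) (auto simp: \<tau>_def)
    finally show "norm (y' \<tau>) \<le> 1/2 * norm h" using near[OF y y', of \<tau>] \<tau> by simp
  qed
  moreover have "range (K' t) \<subseteq> span E" for t using E(2) by (auto simp: K'_def)
  ultimately have "LPFS_wrt (span E) S B D T"
    unfolding LPFS_wrt_def using K' perK' by auto
  then show "\<exists>Z. subspace Z \<and> (\<exists>E. finite E \<and> span E = Z) \<and> LPFS_wrt Z S B D T"
    using E(1) subspace_span by blast
qed

end
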